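(* Let $w\in[\mathbf{F}_r,\mathbf{F}_r]$ and let $g=\mathrm{cl}(w)$ be its commutator length. Then, as $n\to\infty$, $$\mathcal{T}r_w(n)=O\left(\frac{1}{n^{2g-1}}\right).$$
   Context: $\mathbf{F}_r$ is the free group on generators $x_1,\ldots,x_r$. $\mathcal{U}(n)$ is the group of $n\times n$ complex unitary matrices with its Haar probability measure $\mu_n$. A word $w=\prod_{j}x_{i_j}^{\varepsilon_j}\in\mathbf{F}_r$ ($\varepsilon_j=\pm1$) induces the word map $w:\mathcal{U}(n)^r\to\mathcal{U}(n)$, $w(u_1,\ldots,u_r)=\prod_j u_{i_j}^{\varepsilon_j}$. Let $U_1^{(n)},\ldots,U_r^{(n)}$ be independent Haar-random elements of $\mathcal{U}(n)$ and define $\mathcal{T}r_w(n)=\mathbb{E}\big[\mathrm{tr}\big(w(U_1^{(n)},\ldots,U_r^{(n)})\big)\big]$, where $\mathrm{tr}$ is the standard (unnormalized) trace. With $[x,y]=xyx^{-1}y^{-1}$, the commutator length $\mathrm{cl}(w)$ of $w\in[\mathbf{F}_r,\mathbf{F}_r]$ is the smallest $g\ge 0$ such that $w=[u_1,v_1]\cdots[u_g,v_g]$ for some $u_i,v_i\in\mathbf{F}_r$. *)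

theory Defs
  imports
    "HOL-Probability.Probability"
    "HOL-Library.Landau_Symbols"
    "HOL-Algebra.Generated_Groups"
    "Jordan_Normal_Form.Schur_Decomposition"
begin

section \<open>The free group on finitely many generators\<close>

text \<open>The letter \<open>(i, True)\<close> is the generator with index \<open>i\<close> and \<open>(i, False)\<close> is its inverse.
  The generators of the free group of rank \<open>r\<close> carry the indices \<open>0, \<dots>, r - 1\<close>, and each
  element is represented by its unique reduced word.\<close>

type_synonym letter = "nat \<times> bool"

definition inv_letter :: "letter \<Rightarrow> letter" where
  "inv_letter a = (fst a, \<not> snd a)"

fun reduced :: "letter list \<Rightarrow> bool" where
  "reduced (a # b # bs) \<longleftrightarrow> b \<noteq> inv_letter a \<and> reduced (b # bs)"
| "reduced _ \<longleftrightarrow> True"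

fun cancel_cons :: "letter \<Rightarrow> letter list \<Rightarrow> letter list" where
  "cancel_cons a [] = [a]"
| "cancel_cons a (b # bs) = (if b = inv_letter a then bs else a # b # bs)"

definition reduce :: "letter list \<Rightarrow> letter list" where
  "reduce w = foldr cancel_cons w []"

definition free_group :: "nat \<Rightarrow> letter list monoid" where
  "free_group r = \<lparr>carrier = {w. reduced w \<and> fst ` set w \<subseteq> {..<r}},
                   mult = (\<lambda>v w. reduce (v @ w)), one = []\<rparr>"

lemma inv_letter_inv_letter [simp]: "inv_letter (inv_letter a) = a"
  by (simp add: inv_letter_def)

lemma fst_inv_letter [simp]: "fst (inv_letter a) = fst a"
  by (simp add: inv_letter_def)

lemma reduced_Cons: "reduced (a # w) \<Longrightarrow> reduced w"
  by (cases w) auto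

lemma reduced_cancel_cons: "reduced w \<Longrightarrow> reduced (cancel_cons a w)"
  by (cases w) (auto dest: reduced_Cons)

lemma reduced_foldr: "reduced v \<Longrightarrow> reduced (foldr cancel_cons w v)"
  by (induction w) (auto intro: reduced_cancel_cons)

lemma reduced_reduce: "reduced (reduce w)"
  by (simp add: reduce_def reduced_foldr)

lemma reduce_reduced: "reduced w \<Longrightarrow> reduce w = w"
proof (induction w)
  case (Cons a w)
  then show ?case
    by (cases w) (auto simp: reduce_def)
qed (simp add: reduce_def)

lemma cancel_cons_inverse:
  "reduced w \<Longrightarrow> cancel_cons a (cancel_cons (inv_letter a) w) = w"
  by (cases "(a, w)" rule: cancel_cons.cases; cases "tl w") auto

lemma foldr_cancel_cons:
  "reduced s \<Longrightarrow> foldr cancel_cons (cancel_cons a w) s = cancel_cons a (foldr cancel_cons w s)"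
proof (cases w)
  case (Cons b bs)
  assume "reduced s"
  then show ?thesis
    using Cons cancel_cons_inverse[of "foldr cancel_cons bs s" a]
    by (auto simp: reduced_foldr)
qed simp

lemma foldr_reduce: "reduced s \<Longrightarrow> foldr cancel_cons (reduce w) s = foldr cancel_cons w s"
  by (induction w) (auto simp: reduce_def foldr_cancel_cons)

lemma reduce_append_left: "reduce (reduce v @ w) = reduce (v @ w)"
  using foldr_reduce[of "reduce w" v] reduced_reduce[of w] by (simp add: reduce_def)

lemma reduce_append_right: "reduce (v @ reduce w) = reduce (v @ w)"
  using reduce_reduced[OF reduced_reduce, of w] by (simp add: reduce_def)

lemma set_reduce: "set (reduce w) \<subseteq> set w"
proof (induction w)
  case (Cons a w)
  then show ?case
    by (cases "reduce w") (auto simp: reduce_def)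
qed (simp add: reduce_def)

lemma reduce_inverse: "reduce (map inv_letter (rev w) @ w) = []"
proof (induction w)
  case (Cons a w)
  have "reduce (map inv_letter (rev (a # w)) @ a # w)
      = foldr cancel_cons (map inv_letter (rev w)) (cancel_cons (inv_letter a) (cancel_cons a (reduce w)))"
    by (simp add: reduce_def)
  also have "\<dots> = reduce (map inv_letter (rev w) @ w)"
    using cancel_cons_inverse[OF reduced_reduce[of w], of "inv_letter a"] by (simp add: reduce_def)
  finally show ?case using Cons by simp
qed (simp add: reduce_def)

lemma free_group_is_group: "group (free_group r)"
proof (rule groupI)
  fix x y assume "x \<in> carrier (free_group r)" "y \<in> carrier (free_group r)"
  then show "x \<otimes>\<^bsub>free_group r\<^esub> y \<in> carrier (free_group r)"
    using image_mono[OF set_reduce[of "x @ y"], of fst]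
    by (simp add: free_group_def reduced_reduce image_Un) blast
next
  fix x assume x: "x \<in> carrier (free_group r)"
  let ?y = "reduce (map inv_letter (rev x))"
  have "?y \<otimes>\<^bsub>free_group r\<^esub> x = \<one>\<^bsub>free_group r\<^esub>"
    by (simp add: free_group_def reduce_append_left reduce_inverse)
  moreover have "?y \<in> carrier (free_group r)"
  proof -
    have "fst ` set ?y \<subseteq> fst ` inv_letter ` set x"
      using set_reduce[of "map inv_letter (rev x)"] by (intro image_mono) simp
    also have "\<dots> = fst ` set x" by (simp add: image_image)
    finally show ?thesis using x by (auto simp: free_group_def reduced_reduce)
  qed
  ultimately show "\<exists>y\<in>carrier (free_group r). y \<otimes>\<^bsub>free_group r\<^esub> x = \<one>\<^bsub>free_group r\<^esub>"
    by blast
qed (auto simp: free_group_def reduce_reduced reduce_append_left reduce_append_right)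


section \<open>Commutator length and word maps\<close>

definition commutator :: "('a, 'b) monoid_scheme \<Rightarrow> 'a \<Rightarrow> 'a \<Rightarrow> 'a" where
  "commutator G x y = x \<otimes>\<^bsub>G\<^esub> y \<otimes>\<^bsub>G\<^esub> inv\<^bsub>G\<^esub> x \<otimes>\<^bsub>G\<^esub> inv\<^bsub>G\<^esub> y"

definition list_prod :: "('a, 'b) monoid_scheme \<Rightarrow> 'a list \<Rightarrow> 'a" where
  "list_prod G xs = foldr (mult G) xs \<one>\<^bsub>G\<^esub>"

text \<open>Meaningful for elements of the commutator subgroup \<^term>\<open>derived G (carrier G)\<close> only;
  elsewhere the set of admissible lengths is empty.\<close>

definition commutator_length :: "('a, 'b) monoid_scheme \<Rightarrow> 'a \<Rightarrow> nat" where
  "commutator_length G w = (LEAST g. \<exists>ps. length ps = g \<and> set ps \<subseteq> carrier G \<times> carrier G \<and>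
     w = list_prod G (map (\<lambda>(u, v). commutator G u v) ps))"

definition word_map :: "('a, 'b) monoid_scheme \<Rightarrow> letter list \<Rightarrow> (nat \<Rightarrow> 'a) \<Rightarrow> 'a" where
  "word_map G w u = list_prod G (map (\<lambda>(i, b). if b then u i else inv\<^bsub>G\<^esub> (u i)) w)"


section \<open>Haar-random unitary matrices\<close>

definition unitary_group :: "nat \<Rightarrow> complex mat monoid" where
  "unitary_group n = \<lparr>carrier = {A \<in> carrier_mat n n. A * mat_adjoint A = 1\<^sub>m n},
                      mult = (*), one = 1\<^sub>m n\<rparr>"

definition mat_trace :: "complex mat \<Rightarrow> complex" where
  "mat_trace A = (\<Sum>i<dim_row A. A $$ (i, i))"

text \<open>Matrices of size \<open>n\<close> are embedded into a product of copies of the complex plane by their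
  entries, padded with zeros.  The Borel \<open>\<sigma>\<close>-algebra of the unitary group (with the subspace
  topology) is the pullback of the Borel \<open>\<sigma>\<close>-algebra along this embedding.\<close>

definition mat_entries :: "nat \<Rightarrow> complex mat \<Rightarrow> nat \<times> nat \<Rightarrow> complex" where
  "mat_entries n A = (\<lambda>(i, j). if i < n \<and> j < n then A $$ (i, j) else 0)"

definition unitary_borel :: "nat \<Rightarrow> complex mat measure" where
  "unitary_borel n = vimage_algebra (carrier (unitary_group n)) (mat_entries n) borel"

definition is_haar_prob :: "nat \<Rightarrow> complex mat measure \<Rightarrow> bool" where
  "is_haar_prob n \<mu> \<longleftrightarrow> sets \<mu> = sets (unitary_borel n) \<and> prob_space \<mu> \<and>
     (\<forall>A\<in>carrier (unitary_group n). distr \<mu> \<mu> (\<lambda>B. A \<otimes>\<^bsub>unitary_group n\<^esub> B) = \<mu>)"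

lemma sets_unitary_borel:
  "sets (unitary_borel n) = sigma_sets (carrier (unitary_group n))
     {mat_entries n -` S \<inter> carrier (unitary_group n) | S. open S}"
  unfolding unitary_borel_def borel_def
  by (subst vimage_algebra_sigma) (auto simp: sets_measure_of_conv)

lemma mat_adjoint_carrier: "A \<in> carrier_mat n m \<Longrightarrow> mat_adjoint A \<in> carrier_mat m n"
  by (rule carrier_matI) (simp_all add: mat_adjoint_def)

lemma mat_adjoint_index:
  "A \<in> carrier_mat n m \<Longrightarrow> i < m \<Longrightarrow> j < n \<Longrightarrow> mat_adjoint A $$ (i, j) = cnj (A $$ (j, i))"
  by (frule carrier_matD(1), drule carrier_matD(2)) (simp add: mat_adjoint_def mat_of_rows_def)

lemma mat_adjoint_mult:
  fixes A B :: "complex mat"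
  assumes A: "A \<in> carrier_mat n n" and B: "B \<in> carrier_mat n n"
  shows "mat_adjoint (A * B) = mat_adjoint B * mat_adjoint A"
proof -
  note cA = carrier_matD[OF mat_adjoint_carrier[OF A]]
  note cB = carrier_matD[OF mat_adjoint_carrier[OF B]]
  note AB = mult_carrier_mat[OF A B]
  note cAB = carrier_matD[OF mat_adjoint_carrier[OF AB]]
  show ?thesis
  proof (rule eq_matI)
    fix i j assume "i < dim_row (mat_adjoint B * mat_adjoint A)"
      "j < dim_col (mat_adjoint B * mat_adjoint A)"
    then have ij: "i < n" "j < n" by (simp_all add: cA cB)
    have "mat_adjoint (A * B) $$ (i, j) = cnj ((A * B) $$ (j, i))"
      by (rule mat_adjoint_index[OF AB ij])
    also have "\<dots> = (\<Sum>k<n. cnj (A $$ (j, k)) * cnj (B $$ (k, i)))"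
      using ij carrier_matD[OF A] carrier_matD[OF B]
      by (simp add: scalar_prod_def lessThan_atLeast0)
    also have "\<dots> = (\<Sum>k<n. mat_adjoint B $$ (i, k) * mat_adjoint A $$ (k, j))"
      by (rule sum.cong) (simp_all add: ij mat_adjoint_index[OF A] mat_adjoint_index[OF B])
    also have "\<dots> = (mat_adjoint B * mat_adjoint A) $$ (i, j)"
      using ij by (simp add: cA cB scalar_prod_def lessThan_atLeast0)
    finally show "mat_adjoint (A * B) $$ (i, j) = (mat_adjoint B * mat_adjoint A) $$ (i, j)" .
  qed (simp_all only: cA cB cAB index_mult_mat(2,3))
qed

lemma mat_adjoint_mat_adjoint:
  fixes A :: "complex mat"
  assumes A: "A \<in> carrier_mat n n"
  shows "mat_adjoint (mat_adjoint A) = A"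
proof -
  note c = mat_adjoint_carrier[OF A]
  note cc = carrier_matD[OF mat_adjoint_carrier[OF c]]
  show ?thesis
  proof (rule eq_matI)
    fix i j assume "i < dim_row A" "j < dim_col A"
    then have ij: "i < n" "j < n" by (simp_all only: carrier_matD[OF A])
    show "mat_adjoint (mat_adjoint A) $$ (i, j) = A $$ (i, j)"
      by (simp only: mat_adjoint_index[OF c ij] mat_adjoint_index[OF A ij(2,1)] complex_cnj_cnj)
  qed (simp_all only: cc carrier_matD[OF A])
qed

lemma unitary_group_is_group: "group (unitary_group n)"
proof (rule groupI)
  fix A B assume "A \<in> carrier (unitary_group n)" "B \<in> carrier (unitary_group n)"
  then have A: "A \<in> carrier_mat n n" "A * mat_adjoint A = 1\<^sub>m n"
    and B: "B \<in> carrier_mat n n" "B * mat_adjoint B = 1\<^sub>m n"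
    by (auto simp: unitary_group_def)
  note c = mat_adjoint_carrier[OF A(1)] mat_adjoint_carrier[OF B(1)]
  have "A * B * mat_adjoint (A * B) = A * (B * mat_adjoint B) * mat_adjoint A"
    unfolding mat_adjoint_mult[OF A(1) B(1)]
    by (simp only: assoc_mult_mat[OF A(1) B(1) mult_carrier_mat[OF c(2) c(1)]]
        assoc_mult_mat[OF A(1) mult_carrier_mat[OF B(1) c(2)] c(1)] assoc_mult_mat[OF B(1) c(2) c(1)])
  also have "\<dots> = 1\<^sub>m n" using A B by simp
  finally show "A \<otimes>\<^bsub>unitary_group n\<^esub> B \<in> carrier (unitary_group n)"
    using mult_carrier_mat[OF A(1) B(1)] by (simp add: unitary_group_def)
next
  have "mat_adjoint (1\<^sub>m n :: complex mat) = 1\<^sub>m n"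
    using carrier_matD[OF mat_adjoint_carrier[OF one_carrier_mat[of n, where ?'a = complex]]]
    by (intro eq_matI) (simp_all add: mat_adjoint_index[OF one_carrier_mat])
  then show "\<one>\<^bsub>unitary_group n\<^esub> \<in> carrier (unitary_group n)"
    by (simp add: unitary_group_def)
next
  fix A assume "A \<in> carrier (unitary_group n)"
  then have A: "A \<in> carrier_mat n n" "A * mat_adjoint A = 1\<^sub>m n"
    by (auto simp: unitary_group_def)
  have "mat_adjoint A * A = 1\<^sub>m n"
    using mat_mult_left_right_inverse[OF A(1) mat_adjoint_carrier[OF A(1)] A(2)] .
  then show "\<exists>B\<in>carrier (unitary_group n). B \<otimes>\<^bsub>unitary_group n\<^esub> A = \<one>\<^bsub>unitary_group n\<^esub>"
    using A mat_adjoint_carrier[OF A(1)]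
    by (intro bexI[of _ "mat_adjoint A"]) (simp_all add: unitary_group_def mat_adjoint_mat_adjoint)
next
  fix A B C assume "A \<in> carrier (unitary_group n)" "B \<in> carrier (unitary_group n)"
    "C \<in> carrier (unitary_group n)"
  then have "A \<in> carrier_mat n n" "B \<in> carrier_mat n n" "C \<in> carrier_mat n n"
    by (simp_all add: unitary_group_def)
  then show "A \<otimes>\<^bsub>unitary_group n\<^esub> B \<otimes>\<^bsub>unitary_group n\<^esub> C
    = A \<otimes>\<^bsub>unitary_group n\<^esub> (B \<otimes>\<^bsub>unitary_group n\<^esub> C)"
    by (simp add: unitary_group_def assoc_mult_mat[of A n n B n C n])
qed (auto simp: unitary_group_def)

definition expected_trace ::
  "'a measure \<Rightarrow> nat \<Rightarrow> letter list \<Rightarrow> (nat \<Rightarrow> 'a \<Rightarrow> complex mat) \<Rightarrow> complex" where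
  "expected_trace M n w U = (\<integral>x. mat_trace (word_map (unitary_group n) w (\<lambda>i. U i x)) \<partial>M)"

definition indep_haar_unitaries ::
  "'a measure \<Rightarrow> nat \<Rightarrow> nat \<Rightarrow> (nat \<Rightarrow> 'a \<Rightarrow> complex mat) \<Rightarrow> bool" where
  "indep_haar_unitaries M n r U \<longleftrightarrow> prob_space M \<and>
     prob_space.indep_vars M (\<lambda>_. unitary_borel n) U {..<r} \<and>
     (\<forall>i<r. is_haar_prob n (distr M (unitary_borel n) (U i)))"

end

theory Submission
  imports Defs
begin

text \<open>Write \<open>g\<close> for the commutator length of \<open>w\<close> and \<open>E(w\<^sub>1, \<dots>, w\<^sub>k)\<close> for the expectation of
\<open>tr w\<^sub>1 \<cdots> tr w\<^sub>k\<close> at Haar-random unitary matrices.  The proof uses no formula for the integrals of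
polynomials over the unitary group, only the loop (Schwinger--Dyson) equations between such
expectations, which carry the whole topology of the problem.

Since the Haar measure is left invariant, an expectation does not change when one generator \<open>u\<^sub>i\<close>
is replaced by \<open>V u\<^sub>i\<close>.  Let \<open>V\<close> be close to the identity and compare the terms of first order: the
sum of the terms obtained by inserting a matrix \<open>A\<close> before every \<open>x\<^sub>i\<close> and, with a minus sign, after every
\<open>x\<^sub>i\<^sup>-\<^sup>1\<close> has expectation zero.  This holds for \<open>A = v v\<^sup>*\<close> with a unit vector \<open>v\<close>, hence by polarization for
every \<open>A\<close>.  Apply it to the entry \<open>(p, q)\<close> of \<open>w\<^sub>1\<close> times \<open>tr w\<^sub>2 \<cdots> tr w\<^sub>k\<close> with \<open>A\<close> the matrix unit at
\<open>(p, q)\<close>, and sum over \<open>p\<close> and \<open>q\<close>.  An insertion into \<open>w\<^sub>1 = a b\<close> gives \<open>tr a tr b\<close>, and an insertion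
into another word \<open>w\<^sub>l = a b\<close> gives \<open>tr (w\<^sub>1 b a)\<close>.  This is lemma \<open>loop_equation\<close>.  If exactly one
end of \<open>w\<^sub>1\<close> takes part (up to rotation and cancellation of \<open>x a x\<^sup>-\<^sup>1\<close> to \<open>a\<close>, this can be arranged for
a nonempty word), the insertion at that end gives \<open>n tr w\<^sub>1\<close>, so that \<open>n E(w\<^sub>1, \<dots>, w\<^sub>k)\<close> is, up to signs,
the sum of the expectations in which \<open>w\<^sub>1\<close> is split or is merged with another word.

Splitting and merging are the elementary moves of surfaces.  Say that \<open>(w\<^sub>1, \<dots>, w\<^sub>k)\<close> is admissible
with genus \<open>h\<close> if \<open>w\<close> is a product of conjugates of \<open>w\<^sub>1, \<dots>, w\<^sub>k\<close> and of \<open>h\<close> commutators: a connected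
surface of genus \<open>h\<close> with boundary curves \<open>w\<close> and \<open>w\<^sub>1, \<dots>, w\<^sub>k\<close>.  The claim (\<open>surface_bound_holds\<close>) is that
then \<open>E(w\<^sub>1, \<dots>, w\<^sub>k) = O(n\<^bsup>k + 2 h - 2 g\<^esup>)\<close>.  For \<open>k = 1\<close>, \<open>h = 0\<close>, \<open>w\<^sub>1 = w\<close> this is the theorem.
A split adds a boundary curve and keeps the genus; a merge removes one and raises the genus by one; in
both cases the exponent grows by exactly one, which the factor \<open>n\<close> of the loop equation makes up for.
If \<open>h \<ge> g\<close> the bound is trivial, because a trace is at most \<open>n\<close>.  So merging can be handled by induction on
\<open>g - h\<close>, and splitting by induction on the lengths of the words.  The commutator length enters where no words
are left: then \<open>w\<close> is a product of \<open>h\<close> commutators, so \<open>h \<ge> g\<close>.\<close>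

section \<open>Products of conjugates and commutators\<close>

text \<open>The surface is recorded algebraically: \<open>z\<close> is a product, in some order, of \<open>h\<close> commutators and of one
conjugate of each element of \<open>X\<close>.  Geometrically \<open>z\<close> bounds a connected surface of genus \<open>h\<close> together with
the curves in \<open>X\<close>.\<close>

inductive cobordism :: "('a, 'b) monoid_scheme \<Rightarrow> 'a multiset \<Rightarrow> nat \<Rightarrow> 'a \<Rightarrow> bool"
  for G where
  empty: "cobordism G {#} 0 \<one>\<^bsub>G\<^esub>"
| handle: "cobordism G X h z \<Longrightarrow> a \<in> carrier G \<Longrightarrow> b \<in> carrier G \<Longrightarrow>
    cobordism G X (Suc h) (commutator G a b \<otimes>\<^bsub>G\<^esub> z)"
| boundary: "cobordism G X h z \<Longrightarrow> x \<in> carrier G \<Longrightarrow> c \<in> carrier G \<Longrightarrow>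
    cobordism G (add_mset x X) h (c \<otimes>\<^bsub>G\<^esub> x \<otimes>\<^bsub>G\<^esub> inv\<^bsub>G\<^esub> c \<otimes>\<^bsub>G\<^esub> z)"

context group
begin

lemma commutator_closed [simp]: "a \<in> carrier G \<Longrightarrow> b \<in> carrier G \<Longrightarrow> commutator G a b \<in> carrier G"
  by (simp add: commutator_def)

lemma cobordism_closed: "cobordism G X h z \<Longrightarrow> z \<in> carrier G"
  by (induction rule: cobordism.induct) auto

lemma cobordism_boundary_closed: "cobordism G X h z \<Longrightarrow> x \<in># X \<Longrightarrow> x \<in> carrier G"
  by (induction rule: cobordism.induct) auto

lemma inv_cancel_left [simp]:
  "a \<in> carrier G \<Longrightarrow> b \<in> carrier G \<Longrightarrow> a \<otimes> (inv a \<otimes> b) = b"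
  "a \<in> carrier G \<Longrightarrow> b \<in> carrier G \<Longrightarrow> inv a \<otimes> (a \<otimes> b) = b"
  by (simp_all flip: m_assoc)

lemma conj_pull_left:
  assumes "k \<in> carrier G" "c \<in> carrier G" "x \<in> carrier G" "y \<in> carrier G"
  shows "k \<otimes> (c \<otimes> x \<otimes> inv c \<otimes> y) = (k \<otimes> c) \<otimes> x \<otimes> inv (k \<otimes> c) \<otimes> (k \<otimes> y)"
  using assms by (simp add: m_assoc inv_mult_group)

text \<open>Factors of the product can be permuted at the price of conjugating them, so any chosen boundary curve can be
brought to the front.  This makes the multiset \<open>X\<close> an adequate index.\<close>

lemma cobordism_boundaryE:
  assumes "cobordism G (add_mset x X) h z"
  obtains c y where "c \<in> carrier G" "x \<in> carrier G" "cobordism G X h y" "z = c \<otimes> x \<otimes> inv c \<otimes> y"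
proof -
  have "\<exists>c y. c \<in> carrier G \<and> cobordism G X h y \<and> z = c \<otimes> x \<otimes> inv c \<otimes> y"
    using assms
  proof (induction "add_mset x X" h z arbitrary: X rule: cobordism.induct)
    case (handle h z a b)
    then obtain c y where c: "c \<in> carrier G" and y: "cobordism G X h y"
      and z: "z = c \<otimes> x \<otimes> inv c \<otimes> y" by blast
    have x: "x \<in> carrier G" using cobordism_boundary_closed[OF handle(1)] by simp
    let ?k = "commutator G a b"
    have "?k \<otimes> z = (?k \<otimes> c) \<otimes> x \<otimes> inv (?k \<otimes> c) \<otimes> (?k \<otimes> y)"
      unfolding z using c x cobordism_closed[OF y] handle by (intro conj_pull_left) auto
    then show ?case using c handle cobordism.handle[OF y handle(3,4)]
      by (intro exI[of _ "?k \<otimes> c"] exI[of _ "?k \<otimes> y"]) auto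
  next
    case (boundary Z h z x' d)
    show ?case
    proof (cases "x' = x")
      case True
      then show ?thesis using boundary by auto
    next
      case False
      then obtain Y where Y: "Z = add_mset x Y" "X = add_mset x' Y"
        using boundary(5) by (metis add_eq_conv_ex)
      then obtain c y where c: "c \<in> carrier G" and y: "cobordism G Y h y"
        and z: "z = c \<otimes> x \<otimes> inv c \<otimes> y" using boundary by blast
      have x: "x \<in> carrier G" using cobordism_boundary_closed[OF boundary(1)] Y by simp
      let ?k = "d \<otimes> x' \<otimes> inv d"
      have "?k \<otimes> z = (?k \<otimes> c) \<otimes> x \<otimes> inv (?k \<otimes> c) \<otimes> (?k \<otimes> y)"
        unfolding z using c x cobordism_closed[OF y] boundary by (intro conj_pull_left) auto
      then show ?thesis using c boundary cobordism.boundary[OF y boundary(3,4)] Y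
        by (intro exI[of _ "?k \<otimes> c"] exI[of _ "?k \<otimes> y"]) auto
    qed
  qed auto
  moreover have "x \<in> carrier G" using cobordism_boundary_closed[OF assms] by simp
  ultimately show ?thesis using that by blast
qed

lemma cobordism_split:
  assumes "cobordism G (add_mset (a \<otimes> b) X) h z" and ab: "a \<in> carrier G" "b \<in> carrier G"
  shows "cobordism G (add_mset a (add_mset b X)) h z"
proof -
  obtain c y where c: "c \<in> carrier G" "cobordism G X h y" and z: "z = c \<otimes> (a \<otimes> b) \<otimes> inv c \<otimes> y"
    using assms(1) by (rule cobordism_boundaryE)
  have "z = c \<otimes> a \<otimes> inv c \<otimes> (c \<otimes> b \<otimes> inv c \<otimes> y)"
    using c ab cobordism_closed[OF c(2)] by (simp add: z m_assoc)
  then show ?thesis using c ab by (auto intro!: cobordism.boundary)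
qed

text \<open>Joining two boundary curves by a band creates a handle: in \<open>x\<close> times a conjugate of \<open>b a\<close>, moving the
conjugating element away costs exactly one commutator.\<close>

lemma cobordism_merge:
  assumes "cobordism G (add_mset x (add_mset (a \<otimes> b) X)) h z"
    and ab: "a \<in> carrier G" "b \<in> carrier G"
  shows "cobordism G (add_mset (x \<otimes> b \<otimes> a) X) (Suc h) z"
proof -
  obtain c y' where c: "c \<in> carrier G" "x \<in> carrier G"
    and y': "cobordism G (add_mset (a \<otimes> b) X) h y'" and z: "z = c \<otimes> x \<otimes> inv c \<otimes> y'"
    using assms(1) by (rule cobordism_boundaryE)
  obtain d y where d: "d \<in> carrier G" and y: "cobordism G X h y"
    and y'_eq: "y' = d \<otimes> (a \<otimes> b) \<otimes> inv d \<otimes> y"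
    using y' by (rule cobordism_boundaryE)
  \<comment> \<open>With these elements \<open>d a b d\<^sup>-\<^sup>1 = k v k\<^sup>-\<^sup>1\<close> and \<open>c x b a c\<^sup>-\<^sup>1 = (c x c\<^sup>-\<^sup>1) v\<close>.\<close>
  define v where "v = c \<otimes> b \<otimes> a \<otimes> inv c"
  define k where "k = d \<otimes> a \<otimes> inv c"
  have cl: "v \<in> carrier G" "k \<in> carrier G" "y \<in> carrier G"
    using ab c d cobordism_closed[OF y] by (auto simp: v_def k_def)
  have "z = c \<otimes> (x \<otimes> b \<otimes> a) \<otimes> inv c \<otimes> (commutator G (inv v) k \<otimes> y)"
    using ab c d cl(3)
    by (simp add: z y'_eq commutator_def v_def k_def m_assoc inv_mult_group)
  then show ?thesis
    using ab c cl by (auto intro!: cobordism.boundary cobordism.handle y)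
qed

lemma cobordism_conj:
  assumes "cobordism G (add_mset (d \<otimes> x \<otimes> inv d) X) h z" "d \<in> carrier G" "x \<in> carrier G"
  shows "cobordism G (add_mset x X) h z"
proof -
  obtain c y where c: "c \<in> carrier G" and y: "cobordism G X h y"
    and z: "z = c \<otimes> (d \<otimes> x \<otimes> inv d) \<otimes> inv c \<otimes> y"
    using assms(1) by (rule cobordism_boundaryE)
  have "z = (c \<otimes> d) \<otimes> x \<otimes> inv (c \<otimes> d) \<otimes> y"
    using c assms cobordism_closed[OF y] by (simp add: z m_assoc inv_mult_group)
  then show ?thesis using c assms by (auto intro!: cobordism.boundary y)
qed

text \<open>\<open>b a\<close> is a conjugate of \<open>a b\<close>: a boundary curve matters only up to cyclic rotation.\<close>

lemma cobordism_swap: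
  assumes "cobordism G (add_mset (a \<otimes> b) X) h z" and ab: "a \<in> carrier G" "b \<in> carrier G"
  shows "cobordism G (add_mset (b \<otimes> a) X) h z"
proof (rule cobordism_conj[of a])
  show "cobordism G (add_mset (a \<otimes> (b \<otimes> a) \<otimes> inv a) X) h z"
    using assms by (simp add: m_assoc)
qed (use ab in auto)

lemma cobordism_drop_one: "cobordism G (add_mset \<one> X) h z \<Longrightarrow> cobordism G X h z"
  by (erule cobordism_boundaryE) (simp add: cobordism_closed)

lemma cobordism_no_boundary:
  assumes "cobordism G {#} h z"
  shows "commutator_length G z \<le> h"
proof -
  have "\<exists>ps. length ps = h \<and> set ps \<subseteq> carrier G \<times> carrier G \<and>
     z = list_prod G (map (\<lambda>(u, v). commutator G u v) ps)"
    using assms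
  proof (induction "{#} :: 'a multiset" h z rule: cobordism.induct)
    case empty
    show ?case by (auto simp: list_prod_def)
  next
    case (handle h z a b)
    then obtain ps where "length ps = h \<and> set ps \<subseteq> carrier G \<times> carrier G \<and>
       z = list_prod G (map (\<lambda>(u, v). commutator G u v) ps)" by blast
    then show ?case using handle
      by (intro exI[of _ "(a, b) # ps"]) (auto simp: list_prod_def)
  qed simp
  then show ?thesis unfolding commutator_length_def by (rule Least_le)
qed

end

section \<open>Cutting words\<close>

lemma free_group_simps [simp]:
  "mult (free_group r) = (\<lambda>v w. reduce (v @ w))" "\<one>\<^bsub>free_group r\<^esub> = []"
  by (simp_all add: free_group_def)

lemma reduce_in_free_group: "fst ` set v \<subseteq> {..<r} \<Longrightarrow> reduce v \<in> carrier (free_group r)"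
  using image_mono[OF set_reduce[of v], of fst] by (auto simp: free_group_def reduced_reduce)

lemma reduce_append: "reduce (a @ b) = reduce a \<otimes>\<^bsub>free_group r\<^esub> reduce b"
  by (simp add: reduce_append_left reduce_append_right)

lemma reduce_conj:
  assumes "fst ` set a \<subseteq> {..<r}" "fst x < r"
  shows "reduce (x # a @ [inv_letter x])
    = reduce [x] \<otimes>\<^bsub>free_group r\<^esub> reduce a \<otimes>\<^bsub>free_group r\<^esub> inv\<^bsub>free_group r\<^esub> reduce [x]"
proof -
  interpret F: group "free_group r" by (rule free_group_is_group)
  have "reduce [inv_letter x] \<otimes>\<^bsub>free_group r\<^esub> reduce [x] = \<one>\<^bsub>free_group r\<^esub>"
    by (simp add: reduce_def)
  then have "inv\<^bsub>free_group r\<^esub> reduce [x] = reduce [inv_letter x]"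
    using assms by (intro F.inv_equality reduce_in_free_group) auto
  moreover have "reduce (x # a @ [inv_letter x]) = reduce (([x] @ a) @ [inv_letter x])" by simp
  ultimately show ?thesis by (metis reduce_append)
qed

text \<open>The places at which a matrix is inserted into a word when the \<open>i\<close>-th generator \<open>u\<close> becomes \<open>V u\<close>: before every
\<open>u\<close>, and, as \<open>(V u)\<^sup>-\<^sup>1 = u\<^sup>-\<^sup>1 V\<^sup>-\<^sup>1\<close>, after every \<open>u\<^sup>-\<^sup>1\<close> with the opposite sign.  Each place is recorded by
its sign and by the two parts into which it cuts the word.\<close>

fun cut_word :: "nat \<Rightarrow> letter list \<Rightarrow> (complex \<times> letter list \<times> letter list) list" where
  "cut_word i [] = []"
| "cut_word i (x # w) =
    (if x = (i, True) then [(1, [], x # w)] else if x = (i, False) then [(-1, [x], w)] else [])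
    @ map (\<lambda>(s, a, b). (s, x # a, b)) (cut_word i w)"

text \<open>The same for a product of traces; the last component collects the words that are not cut.\<close>

fun cut_words ::
  "nat \<Rightarrow> letter list list \<Rightarrow> (complex \<times> letter list \<times> letter list \<times> letter list list) list" where
  "cut_words i [] = []"
| "cut_words i (v # vs) = map (\<lambda>(s, a, b). (s, a, b, vs)) (cut_word i v)
    @ map (\<lambda>(s, a, b, ws). (s, a, b, v # ws)) (cut_words i vs)"

lemma cut_word_append: "(s, a, b) \<in> set (cut_word i w) \<Longrightarrow> a @ b = w"
  by (induction w arbitrary: a) (auto split: if_splits)

lemma cut_word_sign: "(s, a, b) \<in> set (cut_word i w) \<Longrightarrow> norm s = 1"
  by (induction w arbitrary: a) (auto split: if_splits)

lemma cut_words_mset: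
  "(s, a, b, ws) \<in> set (cut_words i vs) \<Longrightarrow> mset vs = add_mset (a @ b) (mset ws)"
  by (induction vs arbitrary: ws) (auto dest: cut_word_append)

lemma cut_words_sign: "(s, a, b, ws) \<in> set (cut_words i vs) \<Longrightarrow> norm s = 1"
  by (induction vs arbitrary: ws) (auto dest: cut_word_sign)

definition proper_cuts :: "nat \<Rightarrow> letter list \<Rightarrow> (complex \<times> letter list \<times> letter list) list" where
  "proper_cuts i w = filter (\<lambda>(s, a, b). a \<noteq> [] \<and> b \<noteq> []) (cut_word i w)"


lemma sum_cut_word_nonempty_suffix:
  fixes f :: "complex \<Rightarrow> letter list \<Rightarrow> letter list \<Rightarrow> complex"
  assumes "w \<noteq> []"
  shows "(\<Sum>(s, a, b)\<leftarrow>filter (\<lambda>(s, a, b). b \<noteq> []) (cut_word i w). f s a b)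
       + (if last w = (i, False) then f (-1) w [] else 0)
    = (\<Sum>(s, a, b)\<leftarrow>cut_word i w. f s a b)"
  using assms
proof (induction w arbitrary: f)
  case (Cons x w)
  show ?case
  proof (cases "w = []")
    case False
    show ?thesis
      using Cons.IH[OF False, of "\<lambda>s a b. f s (x # a) b"] False
      by (auto simp: filter_map o_def case_prod_unfold)
  qed auto
qed simp

text \<open>Separates the cuts at the two ends of \<open>w\<close>.  In the loop equation these carry the leading factor \<open>n\<close>.\<close>

lemma sum_cut_word:
  fixes f :: "complex \<Rightarrow> letter list \<Rightarrow> letter list \<Rightarrow> complex"
  assumes "w \<noteq> []"
  shows "(\<Sum>(s, a, b)\<leftarrow>cut_word i w. f s a b)
    = (\<Sum>(s, a, b)\<leftarrow>proper_cuts i w. f s a b)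
       + (if hd w = (i, True) then f 1 [] w else 0) + (if last w = (i, False) then f (-1) w [] else 0)"
proof -
  obtain x v where w: "w = x # v" using assms by (cases w) auto
  have "(\<Sum>(s, a, b)\<leftarrow>filter (\<lambda>(s, a, b). b \<noteq> []) (cut_word i w). f s a b)
    = (\<Sum>(s, a, b)\<leftarrow>proper_cuts i w. f s a b) + (if hd w = (i, True) then f 1 [] w else 0)"
    by (auto simp: w proper_cuts_def filter_map o_def case_prod_unfold)
  then show ?thesis using sum_cut_word_nonempty_suffix[OF assms, of f i] by (simp add: algebra_simps)
qed

section \<open>First-order expansions\<close>

text \<open>Uniform first-order expansion at \<open>t = 0\<close>, with bounded coefficients.  Because the remainder is bounded
uniformly in \<open>x\<close>, such an expansion can be integrated over \<open>x\<close> term by term, so that no differentiation under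
the integral sign occurs.\<close>

definition expands ::
  "'x set \<Rightarrow> (real \<Rightarrow> 'x \<Rightarrow> complex) \<Rightarrow> ('x \<Rightarrow> complex) \<Rightarrow> ('x \<Rightarrow> complex) \<Rightarrow> bool" where
  "expands X F f d \<longleftrightarrow> (\<exists>C\<ge>0. \<forall>x\<in>X. norm (f x) \<le> C \<and> norm (d x) \<le> C \<and>
     (\<forall>t. \<bar>t\<bar> \<le> 1 \<longrightarrow> norm (F t x - f x - of_real t * d x) \<le> C * t\<^sup>2))"

lemma expandsI:
  assumes "\<And>x. x \<in> X \<Longrightarrow> norm (f x) \<le> C" "\<And>x. x \<in> X \<Longrightarrow> norm (d x) \<le> C"
    "\<And>x t. x \<in> X \<Longrightarrow> \<bar>t\<bar> \<le> 1 \<Longrightarrow> norm (F t x - f x - of_real t * d x) \<le> C * t\<^sup>2"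
  shows "expands X F f d"
  unfolding expands_def
proof (intro exI[of _ "max C 0"] conjI ballI allI impI)
  fix x and t :: real assume "x \<in> X" "\<bar>t\<bar> \<le> 1"
  then show "norm (F t x - f x - of_real t * d x) \<le> max C 0 * t\<^sup>2"
    by (rule order_trans[OF assms(3)]) (simp add: mult_right_mono)
qed (auto intro: le_max_iff_disj[THEN iffD2] assms)

lemma expands_cong:
  assumes "expands X F f d"
    and "\<And>t x. x \<in> X \<Longrightarrow> F t x = G t x" "\<And>x. x \<in> X \<Longrightarrow> f x = g x" "\<And>x. x \<in> X \<Longrightarrow> d x = e x"
  shows "expands X G g e"
  using assms unfolding expands_def by simp

lemma expands_const:
  assumes "\<And>x. x \<in> X \<Longrightarrow> norm (f x) \<le> C"
  shows "expands X (\<lambda>t. f) f (\<lambda>x. 0)"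
  by (rule expandsI[where C = "max C 0"]) (auto intro: order_trans[OF assms])

lemma expands_add:
  assumes "expands X F f d" "expands X G g e"
  shows "expands X (\<lambda>t x. F t x + G t x) (\<lambda>x. f x + g x) (\<lambda>x. d x + e x)"
proof -
  obtain C where C: "C \<ge> 0" "\<And>x. x \<in> X \<Longrightarrow> norm (f x) \<le> C" "\<And>x. x \<in> X \<Longrightarrow> norm (d x) \<le> C"
    "\<And>x t. x \<in> X \<Longrightarrow> \<bar>t\<bar> \<le> 1 \<Longrightarrow> norm (F t x - f x - of_real t * d x) \<le> C * t\<^sup>2"
    using assms(1) unfolding expands_def by blast
  obtain K where K: "K \<ge> 0" "\<And>x. x \<in> X \<Longrightarrow> norm (g x) \<le> K" "\<And>x. x \<in> X \<Longrightarrow> norm (e x) \<le> K"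
    "\<And>x t. x \<in> X \<Longrightarrow> \<bar>t\<bar> \<le> 1 \<Longrightarrow> norm (G t x - g x - of_real t * e x) \<le> K * t\<^sup>2"
    using assms(2) unfolding expands_def by blast
  show ?thesis
  proof (rule expandsI[where C = "C + K"])
    fix x and t :: real assume x: "x \<in> X" "\<bar>t\<bar> \<le> 1"
    have "F t x + G t x - (f x + g x) - of_real t * (d x + e x)
      = (F t x - f x - of_real t * d x) + (G t x - g x - of_real t * e x)"
      by (simp add: algebra_simps)
    then show "norm (F t x + G t x - (f x + g x) - of_real t * (d x + e x)) \<le> (C + K) * t\<^sup>2"
      using norm_triangle_le[OF add_mono[OF C(4)[OF x] K(4)[OF x]]] by (simp add: algebra_simps)
  qed (auto intro!: norm_triangle_le add_mono C K)
qed

lemma expands_mult: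
  assumes "expands X F f d" "expands X G g e"
  shows "expands X (\<lambda>t x. F t x * G t x) (\<lambda>x. f x * g x) (\<lambda>x. f x * e x + d x * g x)"
proof -
  obtain C where C: "C \<ge> 0" "\<And>x. x \<in> X \<Longrightarrow> norm (f x) \<le> C" "\<And>x. x \<in> X \<Longrightarrow> norm (d x) \<le> C"
    "\<And>x t. x \<in> X \<Longrightarrow> \<bar>t\<bar> \<le> 1 \<Longrightarrow> norm (F t x - f x - of_real t * d x) \<le> C * t\<^sup>2"
    using assms(1) unfolding expands_def by blast
  obtain K where K: "K \<ge> 0" "\<And>x. x \<in> X \<Longrightarrow> norm (g x) \<le> K" "\<And>x. x \<in> X \<Longrightarrow> norm (e x) \<le> K"
    "\<And>x t. x \<in> X \<Longrightarrow> \<bar>t\<bar> \<le> 1 \<Longrightarrow> norm (G t x - g x - of_real t * e x) \<le> K * t\<^sup>2"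
    using assms(2) unfolding expands_def by blast
  have CK: "0 \<le> C * K" using C(1) K(1) by simp
  show ?thesis
  proof (rule expandsI[where C = "6 * (C * K)"])
    fix x assume x: "x \<in> X"
    have "norm (f x * g x) \<le> C * K"
      unfolding norm_mult by (intro mult_mono C K x) simp_all
    then show "norm (f x * g x) \<le> 6 * (C * K)" using CK by linarith
    have "norm (f x * e x + d x * g x) \<le> C * K + C * K"
      by (intro norm_triangle_le add_mono) (auto simp: norm_mult intro!: mult_mono C K x)
    then show "norm (f x * e x + d x * g x) \<le> 6 * (C * K)" using CK by linarith
  next
    fix x and t :: real assume x: "x \<in> X" "\<bar>t\<bar> \<le> 1"
    let ?R = "F t x - f x - of_real t * d x" and ?S = "G t x - g x - of_real t * e x"
    have t2: "t\<^sup>2 \<le> 1" using x(2) by (simp add: abs_square_le_1)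
    have td: "norm (of_real t * d x) \<le> C" "norm (of_real t * e x) \<le> K"
      using mult_mono[OF x(2) C(3)[OF x(1)]] mult_mono[OF x(2) K(3)[OF x(1)]]
      by (simp_all add: norm_mult)
    have S: "norm ?S \<le> K" using mult_left_mono[OF t2 K(1)] K(4)[OF x] by simp
    have G: "norm (G t x) \<le> 3 * K"
      using norm_triangle_ineq[of "?S + g x" "of_real t * e x"] norm_triangle_ineq[of ?S "g x"]
        S K(2)[OF x(1)] td(2) by simp
    have fd: "norm (f x + of_real t * d x) \<le> 2 * C"
      using norm_triangle_ineq[of "f x" "of_real t * d x"] C(2)[OF x(1)] td(1) by simp
    \<comment> \<open>The remainder of the product, arranged so that each summand has a factor of order \<open>t\<^sup>2\<close>.\<close>
    have eq: "F t x * G t x - f x * g x - of_real t * (f x * e x + d x * g x)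
      = ?R * G t x + (f x + of_real t * d x) * ?S + (of_real t)\<^sup>2 * (d x * e x)"
      by (simp add: algebra_simps power2_eq_square)
    have "norm (?R * G t x) \<le> (C * t\<^sup>2) * (3 * K)"
      unfolding norm_mult using C(1) by (intro mult_mono C(4) x G) simp_all
    moreover have "norm ((f x + of_real t * d x) * ?S) \<le> (2 * C) * (K * t\<^sup>2)"
      unfolding norm_mult using C(1) by (intro mult_mono K(4) x fd) simp_all
    moreover have "norm ((of_real t)\<^sup>2 * (d x * e x)) \<le> t\<^sup>2 * (C * K)"
      using C(1) by (auto simp: norm_mult norm_power intro!: mult_left_mono mult_mono C K x)
    ultimately show "norm (F t x * G t x - f x * g x - of_real t * (f x * e x + d x * g x))
        \<le> 6 * (C * K) * t\<^sup>2"
      unfolding eq using norm_triangle_ineq[of "?R * G t x + (f x + of_real t * d x) * ?S"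
          "(of_real t)\<^sup>2 * (d x * e x)"]
        norm_triangle_ineq[of "?R * G t x" "(f x + of_real t * d x) * ?S"]
      by (simp add: algebra_simps)
  qed
qed

lemma expands_sum:
  assumes "finite A" "\<And>a. a \<in> A \<Longrightarrow> expands X (F a) (f a) (d a)"
  shows "expands X (\<lambda>t x. \<Sum>a\<in>A. F a t x) (\<lambda>x. \<Sum>a\<in>A. f a x) (\<lambda>x. \<Sum>a\<in>A. d a x)"
  using assms
proof (induction rule: finite_induct)
  case empty
  show ?case by (simp add: expands_const[where C = 0])
next
  case (insert a A)
  show ?case using expands_add[OF insert.prems[of a] insert.IH] insert by simp
qed

text \<open>If the expectation of \<open>F t\<close> is constant, then \<open>t\<close> times the expectation of the linear coefficient is
\<open>O(t\<^sup>2)\<close>, which forces this expectation to vanish.\<close>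

lemma (in prob_space) expands_expectation_0:
  assumes ex: "expands (space M) F f d"
    and int: "\<And>t. integrable M (F t)" "integrable M f" "integrable M d"
    and const: "\<And>t. (\<integral>x. F t x \<partial>M) = (\<integral>x. f x \<partial>M)"
  shows "(\<integral>x. d x \<partial>M) = 0"
proof -
  obtain C where C: "C \<ge> 0"
    "\<And>x t. x \<in> space M \<Longrightarrow> \<bar>t\<bar> \<le> 1 \<Longrightarrow> norm (F t x - f x - of_real t * d x) \<le> C * t\<^sup>2"
    using ex unfolding expands_def by blast
  have bound: "norm (\<integral>x. d x \<partial>M) \<le> C * t" if t: "0 < t" "t \<le> 1" for t :: real
  proof -
    have "of_real t * (\<integral>x. d x \<partial>M) = - (\<integral>x. F t x - f x - of_real t * d x \<partial>M)"
      using int const[of t] by simp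
    then have "t * norm (\<integral>x. d x \<partial>M) = norm (\<integral>x. F t x - f x - of_real t * d x \<partial>M)"
      using t by (metis abs_of_pos norm_minus_cancel norm_mult norm_of_real)
    also have "\<dots> \<le> (\<integral>x. norm (F t x - f x - of_real t * d x) \<partial>M)"
      by (rule integral_norm_bound)
    also have "\<dots> \<le> (\<integral>x. C * t\<^sup>2 \<partial>M)"
      using t int by (intro integral_mono C(2)) auto
    also have "\<dots> = t * (C * t)" by (simp add: prob_space power2_eq_square)
    finally show ?thesis using t by simp
  qed
  have "((\<lambda>t. C * t) \<longlongrightarrow> C * 0) (at_right 0)" by (intro tendsto_intros)
  moreover have "\<forall>\<^sub>F t in at_right 0. norm (\<integral>x. d x \<partial>M) \<le> C * t"
    unfolding eventually_at_right_field using bound by (intro exI[of _ 1]) auto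
  ultimately have "norm (\<integral>x. d x \<partial>M) \<le> C * 0"
    by (intro tendsto_lowerbound) auto
  then show ?thesis by simp
qed

section \<open>Unitary matrices\<close>

abbreviation word_mat :: "nat \<Rightarrow> (nat \<Rightarrow> complex mat) \<Rightarrow> letter list \<Rightarrow> complex mat" where
  "word_mat n u w \<equiv> word_map (unitary_group n) w u"

definition letter_mat :: "nat \<Rightarrow> (nat \<Rightarrow> complex mat) \<Rightarrow> letter \<Rightarrow> complex mat" where
  "letter_mat n u x = (if snd x then u (fst x) else inv\<^bsub>unitary_group n\<^esub> (u (fst x)))"

definition unitary_tuples :: "nat \<Rightarrow> nat \<Rightarrow> (nat \<Rightarrow> complex mat) set" where
  "unitary_tuples n r = {u. \<forall>j<r. u j \<in> carrier (unitary_group n)}"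

lemma unitary_group_simps [simp]:
  "mult (unitary_group n) = (*)" "\<one>\<^bsub>unitary_group n\<^esub> = 1\<^sub>m n"
  by (simp_all add: unitary_group_def)

lemma unitary_carrier_mat: "A \<in> carrier (unitary_group n) \<Longrightarrow> A \<in> carrier_mat n n"
  by (simp add: unitary_group_def)

lemma unitary_inv:
  assumes "A \<in> carrier (unitary_group n)"
  shows "inv\<^bsub>unitary_group n\<^esub> A = mat_adjoint A"
proof -
  interpret G: group "unitary_group n" by (rule unitary_group_is_group)
  have A: "A \<in> carrier_mat n n" "A * mat_adjoint A = 1\<^sub>m n"
    using assms by (auto simp: unitary_group_def)
  have B: "mat_adjoint A * A = 1\<^sub>m n"
    using mat_mult_left_right_inverse[OF A(1) mat_adjoint_carrier[OF A(1)] A(2)] .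
  then have "mat_adjoint A \<in> carrier (unitary_group n)"
    using A mat_adjoint_carrier[OF A(1)] by (simp add: unitary_group_def mat_adjoint_mat_adjoint)
  then show ?thesis using B assms by (intro G.inv_equality) auto
qed

lemma mult_mat_index:
  assumes "A \<in> carrier_mat n n" "B \<in> carrier_mat n n" "p < n" "q < n"
  shows "(A * B) $$ (p, q) = (\<Sum>k<n. A $$ (p, k) * B $$ (k, q))"
  using assms by (simp add: scalar_prod_def lessThan_atLeast0)

lemma mat_trace_eq: "A \<in> carrier_mat n n \<Longrightarrow> mat_trace A = (\<Sum>p<n. A $$ (p, p))"
  by (simp add: mat_trace_def)

lemma mat_trace_mult:
  assumes "A \<in> carrier_mat n n" "B \<in> carrier_mat n n"
  shows "mat_trace (A * B) = (\<Sum>p<n. \<Sum>q<n. A $$ (p, q) * B $$ (q, p))"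
  using assms by (simp add: mat_trace_eq[of _ n] mult_mat_index del: index_mult_mat)

lemma mat_trace_comm:
  assumes "A \<in> carrier_mat n n" "B \<in> carrier_mat n n"
  shows "mat_trace (A * B) = mat_trace (B * A)"
  unfolding mat_trace_mult[OF assms] mat_trace_mult[OF assms(2,1)]
  by (subst sum.swap) (simp add: mult.commute)

lemma unitary_row_norm:
  assumes "A \<in> carrier (unitary_group n)" "p < n"
  shows "(\<Sum>k<n. (norm (A $$ (p, k)))\<^sup>2) = 1"
proof -
  have A: "A \<in> carrier_mat n n" "A * mat_adjoint A = 1\<^sub>m n"
    using assms by (auto simp: unitary_group_def)
  have "(\<Sum>k<n. A $$ (p, k) * mat_adjoint A $$ (k, p)) = 1"
    using mult_mat_index[OF A(1) mat_adjoint_carrier[OF A(1)] assms(2,2)] A assms by simp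
  then have "(\<Sum>k<n. A $$ (p, k) * cnj (A $$ (p, k))) = 1"
    using assms by (simp add: mat_adjoint_index[OF A(1)])
  then have "complex_of_real (\<Sum>k<n. (norm (A $$ (p, k)))\<^sup>2) = 1"
    by (simp only: of_real_sum complex_norm_square)
  then show ?thesis using of_real_eq_1_iff by blast
qed

lemma unitary_entry_bound:
  assumes "A \<in> carrier (unitary_group n)" "p < n" "q < n"
  shows "norm (A $$ (p, q)) \<le> 1"
proof -
  have "(norm (A $$ (p, q)))\<^sup>2 \<le> (\<Sum>k<n. (norm (A $$ (p, k)))\<^sup>2)"
    using assms by (intro member_le_sum) auto
  then show ?thesis using unitary_row_norm[OF assms(1,2)] by (simp add: abs_square_le_1)
qed

lemma unitary_trace_bound:
  assumes "A \<in> carrier (unitary_group n)"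
  shows "norm (mat_trace A) \<le> real n"
proof -
  have "norm (mat_trace A) \<le> (\<Sum>p<n. 1)"
    unfolding mat_trace_eq[OF unitary_carrier_mat[OF assms]]
    using assms by (intro sum_norm_le unitary_entry_bound[where n = n]) auto
  then show ?thesis by simp
qed

lemma letter_mat_closed:
  assumes "u \<in> unitary_tuples n r" "fst x < r"
  shows "letter_mat n u x \<in> carrier (unitary_group n)"
proof -
  interpret G: group "unitary_group n" by (rule unitary_group_is_group)
  show ?thesis using assms by (auto simp: letter_mat_def unitary_tuples_def)
qed

lemma word_mat_Nil: "word_mat n u [] = 1\<^sub>m n"
  by (simp add: word_map_def list_prod_def)

lemma word_mat_Cons: "word_mat n u (x # w) = letter_mat n u x * word_mat n u w"
  by (cases x) (simp add: word_map_def list_prod_def letter_mat_def)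

lemma word_mat_closed:
  assumes "u \<in> unitary_tuples n r" "fst ` set w \<subseteq> {..<r}"
  shows "word_mat n u w \<in> carrier (unitary_group n)"
proof -
  interpret G: group "unitary_group n" by (rule unitary_group_is_group)
  show ?thesis using assms(2)
  proof (induction w)
    case Nil
    show ?case using G.one_closed by (simp add: word_mat_Nil)
  next
    case (Cons x w)
    then show ?case using G.m_closed[OF letter_mat_closed[OF assms(1), of x], of "word_mat n u w"]
      by (simp add: word_mat_Cons)
  qed
qed

lemmas word_mat_carrier = unitary_carrier_mat[OF word_mat_closed]
lemmas letter_mat_carrier = unitary_carrier_mat[OF letter_mat_closed]

lemma word_mat_append:
  assumes u: "u \<in> unitary_tuples n r" and "fst ` set a \<subseteq> {..<r}" "fst ` set b \<subseteq> {..<r}"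
  shows "word_mat n u (a @ b) = word_mat n u a * word_mat n u b"
  using assms(2)
proof (induction a)
  case Nil
  show ?case using word_mat_carrier[OF u assms(3)] by (simp add: word_mat_Nil)
next
  case (Cons x a)
  then show ?case
    using letter_mat_carrier[OF u, of x] word_mat_carrier[OF u, of a] word_mat_carrier[OF u assms(3)]
    by (simp add: word_mat_Cons assoc_mult_mat[of _ n n])
qed

definition word_trace :: "nat \<Rightarrow> (nat \<Rightarrow> complex mat) \<Rightarrow> letter list \<Rightarrow> complex" where
  "word_trace n u w = mat_trace (word_mat n u w)"

lemma word_trace_eq:
  "u \<in> unitary_tuples n r \<Longrightarrow> fst ` set w \<subseteq> {..<r} \<Longrightarrow>
    word_trace n u w = (\<Sum>p<n. word_mat n u w $$ (p, p))"
  unfolding word_trace_def by (intro mat_trace_eq word_mat_carrier)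

lemma word_trace_append:
  assumes u: "u \<in> unitary_tuples n r" and "fst ` set a \<subseteq> {..<r}" "fst ` set b \<subseteq> {..<r}"
  shows "word_trace n u (a @ b)
    = (\<Sum>p<n. \<Sum>q<n. word_mat n u a $$ (p, q) * word_mat n u b $$ (q, p))"
  unfolding word_trace_def word_mat_append[OF assms]
  by (intro mat_trace_mult word_mat_carrier[OF u] assms)

lemma word_trace_rotate:
  assumes u: "u \<in> unitary_tuples n r" and "fst ` set a \<subseteq> {..<r}" "fst ` set b \<subseteq> {..<r}"
  shows "word_trace n u (a @ b) = word_trace n u (b @ a)"
  unfolding word_trace_def word_mat_append[OF assms] word_mat_append[OF assms(1,3,2)]
  by (intro mat_trace_comm[of _ n] word_mat_carrier[OF u] assms)

lemma word_trace_Nil: "word_trace n u [] = of_nat n"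
  by (simp add: word_trace_def word_mat_Nil mat_trace_def)

lemma letter_mat_inv_letter:
  assumes "u \<in> unitary_tuples n r" "fst x < r"
  shows "letter_mat n u (inv_letter x) * letter_mat n u x = 1\<^sub>m n"
proof -
  interpret G: group "unitary_group n" by (rule unitary_group_is_group)
  have "u (fst x) \<in> carrier (unitary_group n)" using assms by (auto simp: unitary_tuples_def)
  then show ?thesis using G.l_inv[of "u (fst x)"] G.r_inv[of "u (fst x)"]
    by (simp add: letter_mat_def inv_letter_def)
qed

lemma word_trace_conj:
  assumes u: "u \<in> unitary_tuples n r" and a: "fst ` set a \<subseteq> {..<r}" and x: "fst x < r"
  shows "word_trace n u (x # a @ [inv_letter x]) = word_trace n u a"
proof -
  have "word_trace n u (x # a @ [inv_letter x]) = word_trace n u (inv_letter x # x # a)"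
    using word_trace_rotate[OF u, of "x # a" "[inv_letter x]"] a x by simp
  also have "word_mat n u (inv_letter x # x # a) = word_mat n u a"
    using letter_mat_inv_letter[OF u x] letter_mat_carrier[OF u x] word_mat_carrier[OF u a]
      letter_mat_carrier[OF u, of "inv_letter x"] x
    by (simp add: word_mat_Cons flip: assoc_mult_mat[of _ n n])
  then have "word_trace n u (inv_letter x # x # a) = word_trace n u a"
    by (simp add: word_trace_def)
  finally show ?thesis .
qed

lemma cut_word_letters:
  "(s, a, b) \<in> set (cut_word i w) \<Longrightarrow> fst ` set w \<subseteq> B \<Longrightarrow> fst ` set a \<subseteq> B \<and> fst ` set b \<subseteq> B"
  by (metis cut_word_append image_Un le_sup_iff set_append)

lemma cut_words_letters:
  assumes "(s, a, b, vs) \<in> set (cut_words i ws)" "\<forall>w\<in>set ws. fst ` set w \<subseteq> B"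
  shows "fst ` set a \<subseteq> B \<and> fst ` set b \<subseteq> B \<and> (\<forall>w\<in>set vs. fst ` set w \<subseteq> B)"
proof -
  have "mset ws = add_mset (a @ b) (mset vs)" by (rule cut_words_mset[OF assms(1)])
  then have "set ws = insert (a @ b) (set vs)" by (metis set_mset_add_mset_insert set_mset_mset)
  then show ?thesis using assms(2) by (auto simp: image_Un simp del: image_subset_iff)
qed

section \<open>Perturbing one generator\<close>

text \<open>For a unit vector \<open>v\<close> this is \<open>exp (\<i> t v v\<^sup>*)\<close>: it multiplies \<open>v\<close> by \<open>cis t\<close> and fixes the orthogonal
complement of \<open>v\<close>.  Projections suffice, by polarization, and their exponentials have this closed form.\<close>

definition phase_mat :: "nat \<Rightarrow> (nat \<Rightarrow> complex) \<Rightarrow> real \<Rightarrow> complex mat" where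
  "phase_mat n v t = mat n n (\<lambda>(j, k). (if j = k then 1 else 0) + (cis t - 1) * (v j * cnj (v k)))"

lemma phase_mat_carrier: "phase_mat n v t \<in> carrier_mat n n"
  by (simp add: phase_mat_def)

lemma mat_adjoint_phase: "mat_adjoint (phase_mat n v t) = phase_mat n v (- t)"
proof -
  have "mat_adjoint (phase_mat n v t) \<in> carrier_mat n n"
    by (intro mat_adjoint_carrier phase_mat_carrier)
  then have dim: "dim_row (mat_adjoint (phase_mat n v t)) = n" "dim_col (mat_adjoint (phase_mat n v t)) = n"
    by auto
  have dims: "dim_row (phase_mat n v (- t)) = n" "dim_col (phase_mat n v (- t)) = n"
    by (simp_all add: phase_mat_def)
  show ?thesis
  proof (rule eq_matI)
    fix j k assume "j < dim_row (phase_mat n v (- t))" "k < dim_col (phase_mat n v (- t))"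
    then have jk: "j < n" "k < n" by (simp_all only: dims)
    show "mat_adjoint (phase_mat n v t) $$ (j, k) = phase_mat n v (- t) $$ (j, k)"
      unfolding mat_adjoint_index[OF phase_mat_carrier jk] using jk
      by (auto simp: phase_mat_def cis_cnj)
  qed (simp_all only: dim dims)
qed

lemma sum_delta_pair:
  fixes a b :: "nat \<Rightarrow> complex"
  assumes "j < n" "k < n"
  shows "(\<Sum>l<n. ((if j = l then 1 else 0) + s * (x * a l)) * ((if l = k then 1 else 0) + t * (b l * y)))
    = (if j = k then 1 else 0) + t * (b j * y) + s * (x * a k) + s * t * x * y * (\<Sum>l<n. a l * b l)"
proof -
  have "(\<Sum>l<n. ((if j = l then 1 else 0) + s * (x * a l)) * ((if l = k then 1 else 0) + t * (b l * y)))
    = (\<Sum>l<n. (if j = l then (if l = k then 1 else 0) + t * (b l * y) else 0)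
        + ((if l = k then s * (x * a l) else 0) + s * t * x * y * (a l * b l)))"
    by (intro sum.cong refl) (simp add: algebra_simps)
  then show ?thesis
    using assms by (simp add: sum.distrib sum.delta' flip: sum_distrib_left)
qed

lemma phase_mat_unitary:
  assumes "(\<Sum>k<n. (norm (v k))\<^sup>2) = 1"
  shows "phase_mat n v t \<in> carrier (unitary_group n)"
proof -
  have v: "(\<Sum>k<n. cnj (v k) * v k) = 1"
  proof -
    have "(\<Sum>k<n. cnj (v k) * v k) = of_real (\<Sum>k<n. (norm (v k))\<^sup>2)"
      by (simp only: of_real_sum complex_norm_square mult.commute)
    then show ?thesis using assms by simp
  qed
  have cis: "cis t * cis (- t) = 1" by (simp add: cis_mult)
  have "phase_mat n v t * phase_mat n v (- t) = 1\<^sub>m n"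
  proof (rule eq_matI)
    fix j k assume "j < dim_row (1\<^sub>m n :: complex mat)" "k < dim_col (1\<^sub>m n :: complex mat)"
    then have jk: "j < n" "k < n" by auto
    have "(phase_mat n v t * phase_mat n v (- t)) $$ (j, k)
      = (\<Sum>l<n. ((if j = l then 1 else 0) + (cis t - 1) * (v j * cnj (v l)))
              * ((if l = k then 1 else 0) + (cis (- t) - 1) * (v l * cnj (v k))))"
      unfolding mult_mat_index[OF phase_mat_carrier phase_mat_carrier jk]
      using jk by (intro sum.cong refl) (simp add: phase_mat_def)
    also have "\<dots> = (if j = k then 1 else 0) + (cis (- t) - 1) * (v j * cnj (v k))
        + (cis t - 1) * (v j * cnj (v k)) + (cis t - 1) * (cis (- t) - 1) * v j * cnj (v k)"
      unfolding sum_delta_pair[OF jk] v by simp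
    also have "\<dots> = (if j = k then 1 else 0) + (cis t * cis (- t) - 1) * (v j * cnj (v k))"
      by (simp add: algebra_simps)
    finally show "(phase_mat n v t * phase_mat n v (- t)) $$ (j, k) = 1\<^sub>m n $$ (j, k)"
      using jk by (simp add: cis)
  qed (simp_all add: phase_mat_def)
  then show ?thesis
    by (simp add: unitary_group_def mat_adjoint_phase phase_mat_carrier)
qed

lemma cis_expansion: "norm (cis t - 1 - \<i> * of_real t) \<le> t\<^sup>2"
proof -
  have "norm (cis t - (\<Sum>k\<le>1. (\<i> * of_real t) ^ k / fact k)) \<le> \<bar>t\<bar> ^ Suc 1 / fact (Suc 1)"
    using iexp_approx1[of t 1] by (simp add: cis_conv_exp)
  also have "\<dots> \<le> t\<^sup>2" by (simp add: fact_numeral power2_eq_square)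
  finally show ?thesis by (simp add: algebra_simps)
qed

lemma expands_cis:
  "expands X (\<lambda>t x. cis t - 1) (\<lambda>x. 0) (\<lambda>x. \<i>)"
  "expands X (\<lambda>t x. cis (- t) - 1) (\<lambda>x. 0) (\<lambda>x. - \<i>)"
proof -
  show "expands X (\<lambda>t x. cis t - 1) (\<lambda>x. 0) (\<lambda>x. \<i>)"
    by (rule expandsI[where C = 1]) (use cis_expansion in \<open>auto simp: mult.commute\<close>)
  show "expands X (\<lambda>t x. cis (- t) - 1) (\<lambda>x. 0) (\<lambda>x. - \<i>)"
    by (rule expandsI[where C = 1]) (use cis_expansion[of "- _"] in \<open>auto simp: mult.commute\<close>)
qed

definition perturb :: "nat \<Rightarrow> (nat \<Rightarrow> complex) \<Rightarrow> nat \<Rightarrow> real \<Rightarrow> (nat \<Rightarrow> complex mat) \<Rightarrow> nat \<Rightarrow> complex mat"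
  where "perturb n v i t u = u(i := phase_mat n v t * u i)"

lemma perturb_closed:
  assumes "u \<in> unitary_tuples n r" "(\<Sum>k<n. (norm (v k))\<^sup>2) = 1"
  shows "perturb n v i t u \<in> unitary_tuples n r"
proof -
  interpret G: group "unitary_group n" by (rule unitary_group_is_group)
  show ?thesis using assms G.m_closed[OF phase_mat_unitary[OF assms(2)]]
    by (auto simp: unitary_tuples_def perturb_def)
qed

lemma letter_mat_perturb:
  assumes u: "u \<in> unitary_tuples n r" and v: "(\<Sum>k<n. (norm (v k))\<^sup>2) = 1" and x: "fst x < r"
  shows "letter_mat n (perturb n v i t u) x = (if x = (i, True) then phase_mat n v t * letter_mat n u x
    else if x = (i, False) then letter_mat n u x * phase_mat n v (- t) else letter_mat n u x)"
proof (cases "x = (i, False)")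
  case True
  interpret G: group "unitary_group n" by (rule unitary_group_is_group)
  have "u i \<in> carrier (unitary_group n)" using u x True by (auto simp: unitary_tuples_def)
  then have "inv\<^bsub>unitary_group n\<^esub> (phase_mat n v t * u i)
    = inv\<^bsub>unitary_group n\<^esub> (u i) * inv\<^bsub>unitary_group n\<^esub> (phase_mat n v t)"
    using G.inv_mult_group[OF phase_mat_unitary[OF v], of "u i"] by simp
  then show ?thesis using True
    by (simp add: letter_mat_def perturb_def unitary_inv[OF phase_mat_unitary[OF v]] mat_adjoint_phase)
qed (cases x; auto simp: letter_mat_def perturb_def)

text \<open>The linear coefficients of the entries of a letter, of a word and of a product of traces, up to the common
factor \<open>\<i>\<close>.  They are defined for an arbitrary matrix \<open>P\<close> in the place of \<open>v v\<^sup>*\<close>, on which they depend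
linearly.\<close>

definition letter_deriv ::
  "nat \<Rightarrow> (nat \<Rightarrow> nat \<Rightarrow> complex) \<Rightarrow> nat \<Rightarrow> (nat \<Rightarrow> complex mat) \<Rightarrow> letter \<Rightarrow> nat \<Rightarrow> nat \<Rightarrow> complex" where
  "letter_deriv n P i u x p q =
     (if x = (i, True) then \<Sum>k<n. P p k * letter_mat n u x $$ (k, q)
      else if x = (i, False) then - (\<Sum>j<n. P j q * letter_mat n u x $$ (p, j)) else 0)"

lemma expands_letter:
  assumes v: "(\<Sum>k<n. (norm (v k))\<^sup>2) = 1" and x: "fst x < r" and pq: "p < n" "q < n"
  shows "expands (unitary_tuples n r) (\<lambda>t u. letter_mat n (perturb n v i t u) x $$ (p, q))
    (\<lambda>u. letter_mat n u x $$ (p, q)) (\<lambda>u. \<i> * letter_deriv n (\<lambda>j k. v j * cnj (v k)) i u x p q)"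
proof -
  let ?X = "unitary_tuples n r"
  let ?L = "\<lambda>u p q. letter_mat n u x $$ (p, q)"
  have const: "expands ?X (\<lambda>t u. c * ?L u p q) (\<lambda>u. c * ?L u p q) (\<lambda>u. 0)" if "p < n" "q < n" for p q c
    by (rule expands_const[where C = "norm c"])
      (auto simp: norm_mult intro!: mult_left_le unitary_entry_bound[OF letter_mat_closed[OF _ x] that])
  have const_sum: "expands ?X (\<lambda>t u. \<Sum>k<n. f k * ?L u (a k) (b k)) (\<lambda>u. \<Sum>k<n. f k * ?L u (a k) (b k)) (\<lambda>u. 0)"
    if "\<And>k. k < n \<Longrightarrow> a k < n \<and> b k < n" for f a b
    using expands_sum[of "{..<n}" ?X "\<lambda>k t u. f k * ?L u (a k) (b k)" _ "\<lambda>k u. 0"] const that by simp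
  have L: "letter_mat n u x \<in> carrier_mat n n" if "u \<in> ?X" for u
    using letter_mat_carrier[OF that x] .
  consider "x = (i, True)" | "x = (i, False)" | "x \<noteq> (i, True)" "x \<noteq> (i, False)" by blast
  then show ?thesis
  proof cases
    case 1
    show ?thesis
    proof (rule expands_cong[OF expands_add[OF const[OF pq, of 1]
          expands_mult[OF expands_cis(1) const_sum[of "\<lambda>k. k" "\<lambda>k. q" "\<lambda>k. v p * cnj (v k)"]]]])
      fix t u assume u: "u \<in> ?X"
      have pert: "letter_mat n (perturb n v i t u) x = phase_mat n v t * letter_mat n u x"
        using letter_mat_perturb[OF u v x] 1 by simp
      have "(phase_mat n v t * letter_mat n u x) $$ (p, q)
        = (\<Sum>k<n. (if p = k then ?L u k q else 0) + (cis t - 1) * (v p * cnj (v k) * ?L u k q))"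
        unfolding mult_mat_index[OF phase_mat_carrier L[OF u] pq] using pq
        by (intro sum.cong refl) (simp add: phase_mat_def algebra_simps)
      then show "1 * ?L u p q + (cis t - 1) * (\<Sum>k<n. v p * cnj (v k) * ?L u k q)
          = letter_mat n (perturb n v i t u) x $$ (p, q)"
        using pq by (simp add: pert sum.distrib sum_distrib_left)
    qed (use pq in \<open>auto simp: letter_deriv_def 1\<close>)
  next
    case 2
    show ?thesis
    proof (rule expands_cong[OF expands_add[OF const[OF pq, of 1]
          expands_mult[OF expands_cis(2) const_sum[of "\<lambda>k. p" "\<lambda>k. k" "\<lambda>k. v k * cnj (v q)"]]]])
      fix t u assume u: "u \<in> ?X"
      have pert: "letter_mat n (perturb n v i t u) x = letter_mat n u x * phase_mat n v (- t)"
        using letter_mat_perturb[OF u v x] 2 by simp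
      have "(letter_mat n u x * phase_mat n v (- t)) $$ (p, q)
        = (\<Sum>k<n. (if k = q then ?L u p k else 0) + (cis (- t) - 1) * (v k * cnj (v q) * ?L u p k))"
        unfolding mult_mat_index[OF L[OF u] phase_mat_carrier pq] using pq
        by (intro sum.cong refl) (simp add: phase_mat_def algebra_simps)
      then show "1 * ?L u p q + (cis (- t) - 1) * (\<Sum>k<n. v k * cnj (v q) * ?L u p k)
          = letter_mat n (perturb n v i t u) x $$ (p, q)"
        using pq by (simp add: pert sum.distrib sum_distrib_left)
    qed (use pq in \<open>auto simp: letter_deriv_def 2\<close>)
  next
    case 3
    show ?thesis
      by (rule expands_cong[OF const[OF pq, of 1]])
        (auto simp: letter_deriv_def 3 letter_mat_perturb[OF _ v x])
  qed
qed

definition word_deriv ::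
  "nat \<Rightarrow> (nat \<Rightarrow> nat \<Rightarrow> complex) \<Rightarrow> nat \<Rightarrow> (nat \<Rightarrow> complex mat) \<Rightarrow> letter list \<Rightarrow> nat \<Rightarrow> nat \<Rightarrow> complex" where
  "word_deriv n P i u w p q = (\<Sum>(s, a, b)\<leftarrow>cut_word i w.
     s * (\<Sum>j<n. \<Sum>k<n. P j k * (word_mat n u a $$ (p, j) * word_mat n u b $$ (k, q))))"

lemma sum_sum_list: "(\<Sum>m\<in>A. \<Sum>z\<leftarrow>zs. f m z) = (\<Sum>z\<leftarrow>zs. \<Sum>m\<in>A. f m z :: 'a :: comm_monoid_add)"
  by (induction zs) (auto simp: sum.distrib)

lemma word_mat_Cons_index:
  assumes u: "u \<in> unitary_tuples n r" and x: "fst x < r" and w: "fst ` set w \<subseteq> {..<r}"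
    and pq: "p < n" "q < n"
  shows "word_mat n u (x # w) $$ (p, q) = (\<Sum>m<n. letter_mat n u x $$ (p, m) * word_mat n u w $$ (m, q))"
  unfolding word_mat_Cons
  by (rule mult_mat_index[OF letter_mat_carrier[OF u x] word_mat_carrier[OF u w] pq])

text \<open>The product rule: a cut of \<open>x # w\<close> lies either next to the letter \<open>x\<close> or inside \<open>w\<close>.\<close>

lemma word_deriv_Cons:
  assumes u: "u \<in> unitary_tuples n r" and x: "fst x < r" and w: "fst ` set w \<subseteq> {..<r}"
    and pq: "p < n" "q < n"
  shows "word_deriv n P i u (x # w) p q
    = (\<Sum>m<n. letter_mat n u x $$ (p, m) * word_deriv n P i u w m q
        + letter_deriv n P i u x p m * word_mat n u w $$ (m, q))"
proof -
  let ?W = "word_mat n u" and ?L = "letter_mat n u x"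
  have tail: "(\<Sum>(s, a, b)\<leftarrow>map (\<lambda>(s, a, b). (s, x # a, b)) (cut_word i w).
      s * (\<Sum>j<n. \<Sum>k<n. P j k * (?W a $$ (p, j) * ?W b $$ (k, q))))
    = (\<Sum>m<n. ?L $$ (p, m) * word_deriv n P i u w m q)"
  proof -
    have "(\<Sum>m<n. ?L $$ (p, m) * word_deriv n P i u w m q)
      = (\<Sum>(s, a, b)\<leftarrow>cut_word i w. \<Sum>m<n. ?L $$ (p, m) *
          (s * (\<Sum>j<n. \<Sum>k<n. P j k * (?W a $$ (m, j) * ?W b $$ (k, q)))))"
      unfolding word_deriv_def
      by (simp add: sum_sum_list case_prod_unfold flip: sum_list_const_mult)
    also have "\<dots> = (\<Sum>(s, a, b)\<leftarrow>cut_word i w.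
        s * (\<Sum>j<n. \<Sum>k<n. P j k * (?W (x # a) $$ (p, j) * ?W b $$ (k, q))))"
    proof (rule arg_cong[where f = sum_list], rule map_cong[OF refl], clarify)
      fix s a b assume "(s, a, b) \<in> set (cut_word i w)"
      then have a: "fst ` set a \<subseteq> {..<r}" using cut_word_letters[OF _ w] by blast
      have "(\<Sum>m<n. ?L $$ (p, m) * (s * (\<Sum>j<n. \<Sum>k<n. P j k * (?W a $$ (m, j) * ?W b $$ (k, q)))))
        = (\<Sum>m<n. \<Sum>j<n. \<Sum>k<n. s * (P j k * (?L $$ (p, m) * ?W a $$ (m, j) * ?W b $$ (k, q))))"
        by (simp add: sum_distrib_left algebra_simps)
      also have "\<dots> = (\<Sum>j<n. \<Sum>k<n. \<Sum>m<n. s * (P j k * (?L $$ (p, m) * ?W a $$ (m, j) * ?W b $$ (k, q))))"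
        by (subst sum.swap, rule sum.cong[OF refl], rule sum.swap)
      also have "\<dots> = s * (\<Sum>j<n. \<Sum>k<n. P j k * (?W (x # a) $$ (p, j) * ?W b $$ (k, q)))"
        using pq by (simp add: word_mat_Cons_index[OF u x a] sum_distrib_left sum_distrib_right)
      finally show "(\<Sum>m<n. ?L $$ (p, m) * (s * (\<Sum>j<n. \<Sum>k<n. P j k * (?W a $$ (m, j) * ?W b $$ (k, q)))))
        = s * (\<Sum>j<n. \<Sum>k<n. P j k * (?W (x # a) $$ (p, j) * ?W b $$ (k, q)))" .
    qed
    finally show ?thesis by (simp add: o_def case_prod_unfold)
  qed
  have head: "(\<Sum>(s, a, b)\<leftarrow>(if x = (i, True) then [(1, [], x # w)] else if x = (i, False) then [(-1, [x], w)] else []).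
      s * (\<Sum>j<n. \<Sum>k<n. P j k * (?W a $$ (p, j) * ?W b $$ (k, q))))
    = (\<Sum>m<n. letter_deriv n P i u x p m * ?W w $$ (m, q))"
  proof -
    have 1: "(\<Sum>j<n. \<Sum>k<n. P j k * (?W [] $$ (p, j) * ?W (x # w) $$ (k, q)))
      = (\<Sum>m<n. (\<Sum>k<n. P p k * ?L $$ (k, m)) * ?W w $$ (m, q))"
    proof -
      have "(\<Sum>j<n. \<Sum>k<n. P j k * (?W [] $$ (p, j) * ?W (x # w) $$ (k, q)))
        = (\<Sum>j<n. if p = j then \<Sum>k<n. P j k * ?W (x # w) $$ (k, q) else 0)"
        using pq by (intro sum.cong refl) (simp add: word_mat_Nil)
      also have "\<dots> = (\<Sum>k<n. \<Sum>m<n. P p k * ?L $$ (k, m) * ?W w $$ (m, q))"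
        using pq by (simp add: word_mat_Cons_index[OF u x w] sum_distrib_left mult.assoc)
      also have "\<dots> = (\<Sum>m<n. (\<Sum>k<n. P p k * ?L $$ (k, m)) * ?W w $$ (m, q))"
        by (subst sum.swap) (simp add: sum_distrib_right)
      finally show ?thesis .
    qed
    have Lx: "?W [x] = ?L" using letter_mat_carrier[OF u x] by (simp add: word_mat_Cons word_mat_Nil)
    have 2: "(\<Sum>j<n. \<Sum>k<n. P j k * (?W [x] $$ (p, j) * ?W w $$ (k, q)))
      = (\<Sum>m<n. (\<Sum>j<n. P j m * ?L $$ (p, j)) * ?W w $$ (m, q))"
      unfolding Lx by (subst sum.swap) (simp add: sum_distrib_right mult.assoc)
    show ?thesis using 1 2 by (auto simp: letter_deriv_def sum_negf)
  qed
  show ?thesis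
    unfolding word_deriv_def[of n P i u "x # w"] cut_word.simps map_append sum_list_append head tail
    by (simp add: sum.distrib)
qed

lemma expands_word:
  assumes v: "(\<Sum>k<n. (norm (v k))\<^sup>2) = 1" and w: "fst ` set w \<subseteq> {..<r}" and pq: "p < n" "q < n"
  shows "expands (unitary_tuples n r) (\<lambda>t u. word_mat n (perturb n v i t u) w $$ (p, q))
    (\<lambda>u. word_mat n u w $$ (p, q)) (\<lambda>u. \<i> * word_deriv n (\<lambda>j k. v j * cnj (v k)) i u w p q)"
  using w pq
proof (induction w arbitrary: p q)
  case Nil
  have "expands (unitary_tuples n r) (\<lambda>t u. word_mat n u [] $$ (p, q)) (\<lambda>u. word_mat n u [] $$ (p, q)) (\<lambda>u. 0)"
    by (rule expands_const[where C = 1]) (use Nil in \<open>simp add: word_mat_Nil\<close>)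
  then show ?case by (simp add: word_deriv_def word_mat_Nil)
next
  case (Cons x w)
  let ?P = "\<lambda>j k. v j * cnj (v k)"
  have x: "fst x < r" and w: "fst ` set w \<subseteq> {..<r}" using Cons.prems by auto
  have "expands (unitary_tuples n r)
    (\<lambda>t u. letter_mat n (perturb n v i t u) x $$ (p, m) * word_mat n (perturb n v i t u) w $$ (m, q))
    (\<lambda>u. letter_mat n u x $$ (p, m) * word_mat n u w $$ (m, q))
    (\<lambda>u. letter_mat n u x $$ (p, m) * (\<i> * word_deriv n ?P i u w m q)
      + \<i> * letter_deriv n ?P i u x p m * word_mat n u w $$ (m, q))" if "m < n" for m
    using Cons that by (intro expands_mult expands_letter v) auto
  then have "expands (unitary_tuples n r)
    (\<lambda>t u. \<Sum>m<n. letter_mat n (perturb n v i t u) x $$ (p, m) * word_mat n (perturb n v i t u) w $$ (m, q))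
    (\<lambda>u. \<Sum>m<n. letter_mat n u x $$ (p, m) * word_mat n u w $$ (m, q))
    (\<lambda>u. \<Sum>m<n. letter_mat n u x $$ (p, m) * (\<i> * word_deriv n ?P i u w m q)
      + \<i> * letter_deriv n ?P i u x p m * word_mat n u w $$ (m, q))"
    by (intro expands_sum) auto
  then show ?case
    using Cons.prems
    by (elim expands_cong)
      (simp_all add: word_mat_Cons_index[OF _ x w] perturb_closed[OF _ v] word_deriv_Cons[OF _ x w]
        sum_distrib_left algebra_simps)
qed

definition trace_prod :: "nat \<Rightarrow> letter list list \<Rightarrow> (nat \<Rightarrow> complex mat) \<Rightarrow> complex" where
  "trace_prod n ws u = (\<Prod>w\<leftarrow>ws. word_trace n u w)"

lemma trace_prod_simps [simp]:
  "trace_prod n [] u = 1" "trace_prod n (w # ws) u = word_trace n u w * trace_prod n ws u"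
  by (simp_all add: trace_prod_def)

definition trace_deriv ::
  "nat \<Rightarrow> (nat \<Rightarrow> nat \<Rightarrow> complex) \<Rightarrow> nat \<Rightarrow> (nat \<Rightarrow> complex mat) \<Rightarrow> letter list list \<Rightarrow> complex" where
  "trace_deriv n P i u ws = (\<Sum>(s, a, b, vs)\<leftarrow>cut_words i ws.
     s * (\<Sum>j<n. \<Sum>k<n. P j k * word_mat n u (b @ a) $$ (k, j)) * trace_prod n vs u)"

lemma word_mat_append_index:
  assumes u: "u \<in> unitary_tuples n r" and ab: "fst ` set a \<subseteq> {..<r}" "fst ` set b \<subseteq> {..<r}"
    and pq: "p < n" "q < n"
  shows "word_mat n u (a @ b) $$ (p, q) = (\<Sum>m<n. word_mat n u a $$ (p, m) * word_mat n u b $$ (m, q))"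
  unfolding word_mat_append[OF u ab]
  by (rule mult_mat_index[OF word_mat_carrier[OF u ab(1)] word_mat_carrier[OF u ab(2)] pq])

lemma trace_word_deriv:
  assumes u: "u \<in> unitary_tuples n r" and w: "fst ` set w \<subseteq> {..<r}"
  shows "(\<Sum>p<n. word_deriv n P i u w p p)
    = (\<Sum>(s, a, b)\<leftarrow>cut_word i w. s * (\<Sum>j<n. \<Sum>k<n. P j k * word_mat n u (b @ a) $$ (k, j)))"
  unfolding word_deriv_def sum_sum_list
proof (rule arg_cong[where f = sum_list], rule map_cong[OF refl], clarify)
  fix s a b assume "(s, a, b) \<in> set (cut_word i w)"
  then have ab: "fst ` set a \<subseteq> {..<r}" "fst ` set b \<subseteq> {..<r}" using cut_word_letters[OF _ w] by blast+
  have "(\<Sum>p<n. s * (\<Sum>j<n. \<Sum>k<n. P j k * (word_mat n u a $$ (p, j) * word_mat n u b $$ (k, p))))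
    = s * (\<Sum>p<n. \<Sum>j<n. \<Sum>k<n. P j k * (word_mat n u b $$ (k, p) * word_mat n u a $$ (p, j)))"
    by (simp add: sum_distrib_left mult_ac)
  also have "\<dots> = s * (\<Sum>j<n. \<Sum>k<n. \<Sum>p<n. P j k * (word_mat n u b $$ (k, p) * word_mat n u a $$ (p, j)))"
    by (rule arg_cong[where f = "\<lambda>x. s * x"], subst sum.swap, rule sum.cong[OF refl], rule sum.swap)
  also have "\<dots> = s * (\<Sum>j<n. \<Sum>k<n. P j k * word_mat n u (b @ a) $$ (k, j))"
    by (simp add: word_mat_append_index[OF u ab(2,1)] sum_distrib_left)
  finally show "(\<Sum>p<n. s * (\<Sum>j<n. \<Sum>k<n. P j k * (word_mat n u a $$ (p, j) * word_mat n u b $$ (k, p))))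
    = s * (\<Sum>j<n. \<Sum>k<n. P j k * word_mat n u (b @ a) $$ (k, j))" .
qed

lemma expands_trace:
  assumes v: "(\<Sum>k<n. (norm (v k))\<^sup>2) = 1" and w: "fst ` set w \<subseteq> {..<r}"
  shows "expands (unitary_tuples n r) (\<lambda>t u. word_trace n (perturb n v i t u) w) (\<lambda>u. word_trace n u w)
    (\<lambda>u. \<i> * (\<Sum>p<n. word_deriv n (\<lambda>j k. v j * cnj (v k)) i u w p p))"
proof (rule expands_cong[OF expands_sum[of "{..<n}"]])
  fix p assume "p \<in> {..<n}"
  then show "expands (unitary_tuples n r) (\<lambda>t u. word_mat n (perturb n v i t u) w $$ (p, p))
    (\<lambda>u. word_mat n u w $$ (p, p)) (\<lambda>u. \<i> * word_deriv n (\<lambda>j k. v j * cnj (v k)) i u w p p)"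
    by (intro expands_word v w) auto
qed (simp_all add: word_trace_eq[OF _ w] perturb_closed[OF _ v] sum_distrib_left)

lemma trace_deriv_Cons:
  assumes u: "u \<in> unitary_tuples n r" and w: "fst ` set w \<subseteq> {..<r}"
  shows "trace_deriv n P i u (w # ws) = word_trace n u w * trace_deriv n P i u ws
    + (\<Sum>p<n. word_deriv n P i u w p p) * trace_prod n ws u"
  unfolding trace_word_deriv[OF u w]
  by (simp add: trace_deriv_def o_def case_prod_unfold mult_ac
      flip: sum_list_const_mult sum_list_mult_const)

lemma expands_trace_prod:
  assumes v: "(\<Sum>k<n. (norm (v k))\<^sup>2) = 1" and "\<forall>w\<in>set ws. fst ` set w \<subseteq> {..<r}"
  shows "expands (unitary_tuples n r) (\<lambda>t u. trace_prod n ws (perturb n v i t u)) (trace_prod n ws)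
    (\<lambda>u. \<i> * trace_deriv n (\<lambda>j k. v j * cnj (v k)) i u ws)"
  using assms(2)
proof (induction ws)
  case Nil
  have "expands (unitary_tuples n r) (\<lambda>t u. 1) (\<lambda>u. 1) (\<lambda>u. 0)"
    by (rule expands_const[where C = 1]) simp
  then show ?case
    by (rule expands_cong) (auto simp: trace_deriv_def)
next
  case (Cons w ws)
  have w: "fst ` set w \<subseteq> {..<r}" using Cons.prems by simp
  have "expands (unitary_tuples n r)
    (\<lambda>t u. word_trace n (perturb n v i t u) w * trace_prod n ws (perturb n v i t u))
    (\<lambda>u. word_trace n u w * trace_prod n ws u)
    (\<lambda>u. word_trace n u w * (\<i> * trace_deriv n (\<lambda>j k. v j * cnj (v k)) i u ws)
      + \<i> * (\<Sum>p<n. word_deriv n (\<lambda>j k. v j * cnj (v k)) i u w p p) * trace_prod n ws u)"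
    using Cons by (intro expands_mult expands_trace v) auto
  then show ?case
    by (rule expands_cong) (auto simp: trace_deriv_Cons[OF _ w] algebra_simps)
qed

text \<open>The matrices \<open>v v\<^sup>*\<close> of unit vectors span all matrices.  For the entry \<open>(p, q)\<close> it is enough to use the basis
vectors and \<open>(e\<^sub>p + z e\<^sub>q) / sqrt 2\<close> with \<open>z = 1\<close> and \<open>z = \<i>\<close>.\<close>

lemma polarization:
  fixes c :: "nat \<Rightarrow> nat \<Rightarrow> complex"
  assumes "\<And>v. (\<Sum>k<n. (norm (v k))\<^sup>2) = 1 \<Longrightarrow> (\<Sum>j<n. \<Sum>k<n. v j * cnj (v k) * c j k) = 0"
    and "p < n" "q < n"
  shows "c p q = 0"
proof -
  have diag: "c j j = 0" if "j < n" for j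
  proof -
    have "(\<Sum>a<n. \<Sum>b<n. of_bool (a = j) * cnj (of_bool (b = j)) * c a b) = 0"
      using that by (intro assms(1)) (simp add: of_bool_def if_distrib[of norm] if_distribR if_distrib[of "\<lambda>x. x\<^sup>2"] cong: if_cong)
    moreover have "(\<Sum>a<n. \<Sum>b<n. of_bool (a = j) * cnj (of_bool (b = j)) * c a b)
      = (\<Sum>a<n. \<Sum>b<n. if b = j then (if a = j then c a b else 0) else 0)"
      by (intro sum.cong refl) auto
    ultimately show ?thesis using that by simp
  qed
  have off: "cnj z * c p q + z * c q p = 0" if z: "norm z = 1" and pq: "p \<noteq> q" for z
  proof -
    define v where "v = (\<lambda>a. if a = p then of_real (1 / sqrt 2) else if a = q then z * of_real (1 / sqrt 2) else 0 :: complex)"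
    have sum2: "(\<Sum>a<n. f a) = f p + f q" if "\<And>a. a \<noteq> p \<Longrightarrow> a \<noteq> q \<Longrightarrow> f a = 0" for f :: "nat \<Rightarrow> 'x :: comm_monoid_add"
    proof -
      have "(\<Sum>a<n. f a) = (\<Sum>a\<in>{p, q}. f a)"
        using assms that by (intro sum.mono_neutral_right) auto
      then show ?thesis using pq by simp
    qed
    have "(\<Sum>k<n. (norm (v k))\<^sup>2) = 1"
      by (subst sum2) (use z pq in \<open>auto simp: v_def norm_mult norm_divide power_divide\<close>)
    then have "(\<Sum>j<n. \<Sum>k<n. v j * cnj (v k) * c j k) = 0" by (rule assms(1))
    moreover have "(\<Sum>j<n. \<Sum>k<n. v j * cnj (v k) * c j k)
      = (v p * cnj (v p) * c p p + v p * cnj (v q) * c p q) + (v q * cnj (v p) * c q p + v q * cnj (v q) * c q q)"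
      by (subst sum2[of "\<lambda>j. \<Sum>k<n. v j * cnj (v k) * c j k"], simp add: v_def,
          subst (1 2) sum2) (auto simp: v_def)
    ultimately have "v p * cnj (v q) * c p q + v q * cnj (v p) * c q p = 0"
      using diag assms(2,3) by simp
    moreover have "v p * cnj (v q) = cnj z / 2" "v q * cnj (v p) = z / 2"
      using pq by (auto simp: v_def simp flip: of_real_mult)
    ultimately show ?thesis by (simp add: field_simps)
  qed
  show ?thesis
  proof (cases "p = q")
    case False
    then show ?thesis using off[of 1] off[of \<i>] by (simp add: algebra_simps add_eq_0_iff)
  qed (use diag assms in auto)
qed

section \<open>Measurability and the joint law\<close>

lemma space_unitary_borel [simp]: "space (unitary_borel n) = carrier (unitary_group n)"
  by (simp add: unitary_borel_def)

lemma measurable_unitary_entry: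
  assumes "p < n" "q < n"
  shows "(\<lambda>A. A $$ (p, q)) \<in> borel_measurable (unitary_borel n)"
proof -
  have "mat_entries n \<in> borel_measurable (unitary_borel n)"
    unfolding unitary_borel_def by (rule measurable_vimage_algebra1) simp
  then have "(\<lambda>A. mat_entries n A (p, q)) \<in> borel_measurable (unitary_borel n)"
    by (rule measurable_product_then_coordinatewise)
  then show ?thesis using assms by (simp add: mat_entries_def)
qed

lemma measurable_into_unitary_borel:
  assumes "\<And>x. x \<in> space N \<Longrightarrow> f x \<in> carrier (unitary_group n)"
    and "\<And>p q. p < n \<Longrightarrow> q < n \<Longrightarrow> (\<lambda>x. f x $$ (p, q)) \<in> borel_measurable N"
  shows "f \<in> measurable N (unitary_borel n)"
  unfolding unitary_borel_def
proof (rule measurable_vimage_algebra2)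
  show "(\<lambda>x. mat_entries n (f x)) \<in> borel_measurable N"
  proof (rule measurable_coordinatewise_then_product)
    fix i :: "nat \<times> nat"
    show "(\<lambda>x. mat_entries n (f x) i) \<in> borel_measurable N"
      using assms(2) by (cases i; cases "fst i < n \<and> snd i < n") (auto simp: mat_entries_def)
  qed
qed (use assms(1) in auto)

lemma measurable_left_mult:
  assumes V: "V \<in> carrier (unitary_group n)"
  shows "(\<lambda>A. V * A) \<in> measurable (unitary_borel n) (unitary_borel n)"
proof (rule measurable_into_unitary_borel)
  interpret G: group "unitary_group n" by (rule unitary_group_is_group)
  show "V * A \<in> carrier (unitary_group n)" if "A \<in> space (unitary_borel n)" for A
    using G.m_closed[OF V] that by simp
  fix p q assume pq: "p < n" "q < n"
  have "(\<lambda>A. \<Sum>k<n. V $$ (p, k) * A $$ (k, q)) \<in> borel_measurable (unitary_borel n)"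
    using pq by (intro borel_measurable_sum borel_measurable_times measurable_unitary_entry) auto
  moreover have "(V * A) $$ (p, q) = (\<Sum>k<n. V $$ (p, k) * A $$ (k, q))"
    if "A \<in> space (unitary_borel n)" for A
    using that by (intro mult_mat_index unitary_carrier_mat V pq) simp
  ultimately show "(\<lambda>A. (V * A) $$ (p, q)) \<in> borel_measurable (unitary_borel n)"
    by (subst measurable_cong) auto
qed

text \<open>A law of an \<open>r\<close>-tuple of unitary matrices that does not change when a single entry is multiplied from the left.
This is the only property of independent Haar unitaries on which the loop equation rests.\<close>

locale invariant_law = prob_space J for J :: "(nat \<Rightarrow> complex mat) measure" +
  fixes n r :: nat
  assumes sets_law: "sets J = sets (\<Pi>\<^sub>M i\<in>{..<r}. unitary_borel n)"
    and invariant: "\<And>i V. i < r \<Longrightarrow> V \<in> carrier (unitary_group n) \<Longrightarrow> distr J J (\<lambda>u. u(i := V * u i)) = J"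
begin

lemma space_law: "u \<in> space J \<Longrightarrow> u \<in> unitary_tuples n r"
  unfolding sets_eq_imp_space_eq[OF sets_law] space_PiM by (auto simp: unitary_tuples_def)

definition bounded_measurable :: "((nat \<Rightarrow> complex mat) \<Rightarrow> complex) \<Rightarrow> bool" where
  "bounded_measurable f \<longleftrightarrow> f \<in> borel_measurable J \<and> (\<exists>C. \<forall>u\<in>space J. norm (f u) \<le> C)"

lemma bounded_measurable_integrable: "bounded_measurable f \<Longrightarrow> integrable J f"
  unfolding bounded_measurable_def by (auto intro!: integrable_const_bound)

lemma bounded_measurable_cong: "bounded_measurable f \<Longrightarrow> (\<And>u. u \<in> space J \<Longrightarrow> f u = g u) \<Longrightarrow> bounded_measurable g"
  unfolding bounded_measurable_def using measurable_cong[of J f g] by auto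

lemma bounded_measurable_const: "bounded_measurable (\<lambda>u. c)"
  unfolding bounded_measurable_def by auto

lemma bounded_measurable_add: "bounded_measurable f \<Longrightarrow> bounded_measurable g \<Longrightarrow> bounded_measurable (\<lambda>u. f u + g u)"
  unfolding bounded_measurable_def by (auto intro: borel_measurable_add) (meson add_mono norm_triangle_le)

lemma bounded_measurable_mult: "bounded_measurable f \<Longrightarrow> bounded_measurable g \<Longrightarrow> bounded_measurable (\<lambda>u. f u * g u)"
proof -
  assume f: "bounded_measurable f" and g: "bounded_measurable g"
  obtain C D where "\<And>u. u \<in> space J \<Longrightarrow> norm (f u) \<le> C" "\<And>u. u \<in> space J \<Longrightarrow> norm (g u) \<le> D"
    using f g unfolding bounded_measurable_def by blast
  then have "norm (f u * g u) \<le> C * D" if "u \<in> space J" for u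
    unfolding norm_mult using that by (intro mult_mono') auto
  then show ?thesis using f g unfolding bounded_measurable_def by (auto intro: borel_measurable_times)
qed

lemma bounded_measurable_sum: "(\<And>a. a \<in> A \<Longrightarrow> bounded_measurable (f a)) \<Longrightarrow> bounded_measurable (\<lambda>u. \<Sum>a\<in>A. f a u)"
  by (induction A rule: infinite_finite_induct) (auto intro: bounded_measurable_const bounded_measurable_add)

lemma bounded_measurable_sum_list: "(\<And>z. z \<in> set zs \<Longrightarrow> bounded_measurable (f z)) \<Longrightarrow> bounded_measurable (\<lambda>u. \<Sum>z\<leftarrow>zs. f z u)"
  by (induction zs) (auto intro: bounded_measurable_const bounded_measurable_add)

lemma measurable_coord: "j < r \<Longrightarrow> (\<lambda>u. u j) \<in> measurable J (unitary_borel n)"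
  unfolding measurable_cong_sets[OF sets_law refl] by (rule measurable_component_singleton) simp

lemma bounded_measurable_letter:
  assumes x: "fst x < r" and pq: "p < n" "q < n"
  shows "bounded_measurable (\<lambda>u. letter_mat n u x $$ (p, q))"
proof -
  have u: "u (fst x) \<in> carrier (unitary_group n)" if "u \<in> space J" for u
    using space_law[OF that] x by (auto simp: unitary_tuples_def)
  have "(\<lambda>u. letter_mat n u x $$ (p, q)) \<in> borel_measurable J"
  proof (cases "snd x")
    case True
    then show ?thesis
      using measurable_compose[OF measurable_coord[OF x] measurable_unitary_entry[OF pq]]
      by (simp add: letter_mat_def)
  next
    case False
    have "(\<lambda>u. cnj (u (fst x) $$ (q, p))) \<in> borel_measurable J"
      using measurable_compose[OF measurable_coord[OF x] measurable_unitary_entry[OF pq(2,1)]]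
      by (intro borel_measurable_continuous_on[where f = cnj] continuous_on_cnj continuous_on_id)
    moreover have "letter_mat n u x $$ (p, q) = cnj (u (fst x) $$ (q, p))" if "u \<in> space J" for u
      using False pq unitary_carrier_mat[OF u[OF that]]
      by (simp add: letter_mat_def unitary_inv[OF u[OF that]] mat_adjoint_index)
    ultimately show ?thesis by (subst measurable_cong) auto
  qed
  moreover have "norm (letter_mat n u x $$ (p, q)) \<le> 1" if "u \<in> space J" for u
    by (rule unitary_entry_bound[OF letter_mat_closed[OF space_law[OF that] x] pq])
  ultimately show ?thesis unfolding bounded_measurable_def by blast
qed

lemma bounded_measurable_word:
  assumes "fst ` set w \<subseteq> {..<r}" "p < n" "q < n"
  shows "bounded_measurable (\<lambda>u. word_mat n u w $$ (p, q))"
  using assms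
proof (induction w arbitrary: p q)
  case Nil
  then show ?case by (simp add: word_mat_Nil bounded_measurable_const)
next
  case (Cons x w)
  have "bounded_measurable (\<lambda>u. \<Sum>m<n. letter_mat n u x $$ (p, m) * word_mat n u w $$ (m, q))"
    using Cons by (intro bounded_measurable_sum bounded_measurable_mult bounded_measurable_letter) auto
  then show ?case
    by (rule bounded_measurable_cong) (use Cons.prems in \<open>simp add: word_mat_Cons_index[OF space_law]\<close>)
qed

lemma bounded_measurable_trace:
  assumes "fst ` set w \<subseteq> {..<r}"
  shows "bounded_measurable (\<lambda>u. word_trace n u w)"
proof -
  have "bounded_measurable (\<lambda>u. \<Sum>p<n. word_mat n u w $$ (p, p))"
    using assms by (intro bounded_measurable_sum bounded_measurable_word) auto
  then show ?thesis
    by (rule bounded_measurable_cong) (use assms in \<open>simp add: word_trace_eq[OF space_law]\<close>)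
qed

lemma bounded_measurable_trace_prod:
  assumes "\<forall>w\<in>set ws. fst ` set w \<subseteq> {..<r}"
  shows "bounded_measurable (trace_prod n ws)"
  using assms
proof (induction ws)
  case (Cons w ws)
  then have "bounded_measurable (\<lambda>u. word_trace n u w * trace_prod n ws u)"
    by (intro bounded_measurable_mult bounded_measurable_trace) auto
  then show ?case by (rule bounded_measurable_cong) simp
next
  case Nil
  show ?case by (rule bounded_measurable_cong[OF bounded_measurable_const[of 1]]) simp
qed

definition mean :: "letter list list \<Rightarrow> complex" where
  "mean ws = (\<integral>u. trace_prod n ws u \<partial>J)"

lemma measurable_update:
  assumes i: "i < r" and V: "V \<in> carrier (unitary_group n)"
  shows "(\<lambda>u. u(i := V * u i)) \<in> measurable J J"
  unfolding measurable_cong_sets[OF refl sets_law]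
proof (rule measurable_fun_upd[where J = "{..<r}"])
  show "(\<lambda>u. u) \<in> J \<rightarrow>\<^sub>M (\<Pi>\<^sub>M i\<in>{..<r}. unitary_borel n)"
    unfolding measurable_cong_sets[OF sets_law refl] by simp
  show "(\<lambda>u. V * u i) \<in> J \<rightarrow>\<^sub>M unitary_borel n"
    by (rule measurable_compose[OF measurable_coord[OF i] measurable_left_mult[OF V]])
qed (use i in auto)

lemma expectation_update:
  assumes i: "i < r" and V: "V \<in> carrier (unitary_group n)" and f: "f \<in> borel_measurable J"
  shows "(\<integral>u. f (u(i := V * u i)) \<partial>J) = (\<integral>u. f u \<partial>J :: complex)"
  using integral_distr[OF measurable_update[OF i V] f] unfolding invariant[OF i V] by simp

lemma bounded_measurable_update:
  assumes i: "i < r" and V: "V \<in> carrier (unitary_group n)" and f: "bounded_measurable f"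
  shows "bounded_measurable (\<lambda>u. f (u(i := V * u i)))"
proof -
  have "(\<lambda>u. f (u(i := V * u i))) \<in> borel_measurable J"
    using f by (intro measurable_compose[OF measurable_update[OF i V]]) (simp add: bounded_measurable_def)
  then show ?thesis using f measurable_space[OF measurable_update[OF i V]] unfolding bounded_measurable_def by blast
qed

text \<open>The linear coefficient of the entry \<open>(p, q)\<close> of \<open>w\<close> times the traces of \<open>ws\<close> when the matrix unit at
\<open>(j, k)\<close> is inserted.\<close>

definition loop_term ::
  "nat \<Rightarrow> letter list \<Rightarrow> letter list list \<Rightarrow> nat \<Rightarrow> nat \<Rightarrow> nat \<Rightarrow> nat \<Rightarrow> (nat \<Rightarrow> complex mat) \<Rightarrow> complex" where
  "loop_term i w ws p q j k u =
     (\<Sum>(s, a, b)\<leftarrow>cut_word i w. s * (word_mat n u a $$ (p, j) * word_mat n u b $$ (k, q))) * trace_prod n ws u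
     + word_mat n u w $$ (p, q) *
       (\<Sum>(s, a, b, vs)\<leftarrow>cut_words i ws. s * word_mat n u (b @ a) $$ (k, j) * trace_prod n vs u)"

lemma bounded_measurable_loop_term:
  assumes w: "fst ` set w \<subseteq> {..<r}" and ws: "\<forall>w\<in>set ws. fst ` set w \<subseteq> {..<r}"
    and "p < n" "q < n" "j < n" "k < n"
  shows "bounded_measurable (loop_term i w ws p q j k)"
proof -
  have "fst ` set (fst (snd z)) \<subseteq> {..<r}" "fst ` set (snd (snd z)) \<subseteq> {..<r}"
    if "z \<in> set (cut_word i w)" for z
    using cut_word_letters[of "fst z" "fst (snd z)" "snd (snd z)", OF _ w] that
    by (simp_all del: image_subset_iff)
  moreover have "fst ` set (fst (snd z)) \<subseteq> {..<r}" "fst ` set (fst (snd (snd z))) \<subseteq> {..<r}"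
    "\<forall>w\<in>set (snd (snd (snd z))). fst ` set w \<subseteq> {..<r}" if "z \<in> set (cut_words i ws)" for z
    using cut_words_letters[of "fst z" "fst (snd z)" "fst (snd (snd z))" "snd (snd (snd z))", OF _ ws] that
    by (simp_all del: image_subset_iff)
  ultimately show ?thesis
    unfolding loop_term_def case_prod_unfold using assms
    by (intro bounded_measurable_add bounded_measurable_mult bounded_measurable_sum_list bounded_measurable_const bounded_measurable_word bounded_measurable_trace_prod)
      (simp_all add: image_Un del: image_subset_iff)
qed

lemma integral_double_sum:
  fixes f :: "nat \<Rightarrow> nat \<Rightarrow> (nat \<Rightarrow> complex mat) \<Rightarrow> complex"
  assumes "\<And>j k. j < n \<Longrightarrow> k < n \<Longrightarrow> integrable J (f j k)"
  shows "(\<integral>u. (\<Sum>j<n. \<Sum>k<n. f j k u) \<partial>J) = (\<Sum>j<n. \<Sum>k<n. \<integral>u. f j k u \<partial>J)"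
proof -
  have "(\<integral>u. (\<Sum>j<n. \<Sum>k<n. f j k u) \<partial>J) = (\<Sum>j<n. \<integral>u. (\<Sum>k<n. f j k u) \<partial>J)"
    using assms by (intro Bochner_Integration.integral_sum Bochner_Integration.integrable_sum) auto
  also have "\<dots> = (\<Sum>j<n. \<Sum>k<n. \<integral>u. f j k u \<partial>J)"
    using assms by (intro sum.cong refl Bochner_Integration.integral_sum) auto
  finally show ?thesis .
qed

text \<open>The expectation of the entry \<open>(p, q)\<close> of \<open>w\<close> times the traces of \<open>ws\<close> does not depend on the perturbation,
so its linear coefficient in the direction \<open>v v\<^sup>*\<close> vanishes for every unit vector \<open>v\<close>.\<close>

lemma expectation_loop_term:
  assumes i: "i < r" and w: "fst ` set w \<subseteq> {..<r}" and ws: "\<forall>w\<in>set ws. fst ` set w \<subseteq> {..<r}"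
    and pq: "p < n" "q < n" and jk: "j < n" "k < n"
  shows "(\<integral>u. loop_term i w ws p q j k u \<partial>J) = 0"
proof (rule polarization[of n "\<lambda>j k. \<integral>u. loop_term i w ws p q j k u \<partial>J", OF _ jk])
  fix v :: "nat \<Rightarrow> complex" assume v: "(\<Sum>k<n. (norm (v k))\<^sup>2) = 1"
  let ?f = "\<lambda>u. word_mat n u w $$ (p, q) * trace_prod n ws u"
  let ?d = "\<lambda>u. \<i> * (\<Sum>j<n. \<Sum>k<n. v j * cnj (v k) * loop_term i w ws p q j k u)"
  have f: "bounded_measurable ?f" by (intro bounded_measurable_mult bounded_measurable_word bounded_measurable_trace_prod w ws pq)
  have d: "bounded_measurable ?d" by (intro bounded_measurable_mult bounded_measurable_const bounded_measurable_sum bounded_measurable_loop_term w ws pq) auto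
  have "(\<integral>u. ?d u \<partial>J) = 0"
  proof (rule expands_expectation_0)
    have "expands (unitary_tuples n r) (\<lambda>t u. ?f (perturb n v i t u)) ?f
      (\<lambda>u. word_mat n u w $$ (p, q) * (\<i> * trace_deriv n (\<lambda>j k. v j * cnj (v k)) i u ws)
         + \<i> * word_deriv n (\<lambda>j k. v j * cnj (v k)) i u w p q * trace_prod n ws u)"
      by (intro expands_mult expands_word expands_trace_prod v w ws pq)
    moreover have "word_mat n u w $$ (p, q) * (\<i> * trace_deriv n (\<lambda>j k. v j * cnj (v k)) i u ws)
         + \<i> * word_deriv n (\<lambda>j k. v j * cnj (v k)) i u w p q * trace_prod n ws u = ?d u" for u
    proof -
      have 1: "word_deriv n (\<lambda>j k. v j * cnj (v k)) i u w p q = (\<Sum>j<n. \<Sum>k<n. v j * cnj (v k) *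
        (\<Sum>(s, a, b)\<leftarrow>cut_word i w. s * (word_mat n u a $$ (p, j) * word_mat n u b $$ (k, q))))"
        unfolding word_deriv_def
        by (simp add: sum_sum_list sum_distrib_left mult_ac case_prod_unfold flip: sum_list_const_mult)
      have 2: "trace_deriv n (\<lambda>j k. v j * cnj (v k)) i u ws = (\<Sum>j<n. \<Sum>k<n. v j * cnj (v k) *
        (\<Sum>(s, a, b, vs)\<leftarrow>cut_words i ws. s * word_mat n u (b @ a) $$ (k, j) * trace_prod n vs u))"
        unfolding trace_deriv_def
        by (simp add: sum_sum_list sum_distrib_left sum_distrib_right mult_ac case_prod_unfold
            flip: sum_list_const_mult)
      show ?thesis
        unfolding 1 2 loop_term_def
        by (simp add: sum_distrib_left sum_distrib_right sum.distrib distrib_left mult_ac)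
    qed
    ultimately show "expands (space J) (\<lambda>t u. ?f (perturb n v i t u)) ?f ?d"
      unfolding expands_def using space_law by simp blast
  next
    show "integrable J (\<lambda>u. ?f (perturb n v i t u))" for t
      unfolding perturb_def by (intro bounded_measurable_integrable bounded_measurable_update[OF i phase_mat_unitary[OF v] f])
    show "(\<integral>u. ?f (perturb n v i t u) \<partial>J) = (\<integral>u. ?f u \<partial>J)" for t
      unfolding perturb_def using f
      by (intro expectation_update[OF i phase_mat_unitary[OF v]]) (simp add: bounded_measurable_def)
  qed (intro bounded_measurable_integrable f d)+
  then have "(\<integral>u. (\<Sum>j<n. \<Sum>k<n. v j * cnj (v k) * loop_term i w ws p q j k u) \<partial>J) = 0"
    by simp
  moreover have "integrable J (\<lambda>u. v j * cnj (v k) * loop_term i w ws p q j k u)" if "j < n" "k < n" for j k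
    using that by (intro integrable_mult_right bounded_measurable_integrable bounded_measurable_loop_term w ws pq)
  ultimately have "(\<Sum>j<n. \<Sum>k<n. (\<integral>u. v j * cnj (v k) * loop_term i w ws p q j k u \<partial>J)) = 0"
    by (subst (asm) integral_double_sum) auto
  then show "(\<Sum>j<n. \<Sum>k<n. v j * cnj (v k) * (\<integral>u. loop_term i w ws p q j k u \<partial>J)) = 0"
    by simp
qed

lemma integral_sum_list:
  assumes "\<And>z. z \<in> set zs \<Longrightarrow> integrable J (f z)"
  shows "(\<integral>u. (\<Sum>z\<leftarrow>zs. f z u) \<partial>J) = (\<Sum>z\<leftarrow>zs. \<integral>u. f z u \<partial>J :: complex)
    \<and> integrable J (\<lambda>u. \<Sum>z\<leftarrow>zs. f z u)"
  using assms by (induction zs) auto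

text \<open>Take \<open>j = p\<close> and \<open>k = q\<close> in \<open>expectation_loop_term\<close> and sum over \<open>p\<close> and \<open>q\<close>: the entries \<open>(p, p)\<close> of \<open>a\<close> and
\<open>(q, q)\<close> of \<open>b\<close> sum up to two traces, and the entries \<open>(p, q)\<close> of \<open>w\<close> and \<open>(q, p)\<close> of \<open>b a\<close> to one.\<close>

theorem loop_equation:
  assumes i: "i < r" and w: "fst ` set w \<subseteq> {..<r}" and ws: "\<forall>w\<in>set ws. fst ` set w \<subseteq> {..<r}"
  shows "(\<Sum>(s, a, b)\<leftarrow>cut_word i w. s * mean (a # b # ws))
    + (\<Sum>(s, a, b, vs)\<leftarrow>cut_words i ws. s * mean ((w @ b @ a) # vs)) = 0"
proof -
  have pointwise: "(\<Sum>p<n. \<Sum>q<n. loop_term i w ws p q p q u)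
    = (\<Sum>(s, a, b)\<leftarrow>cut_word i w. s * trace_prod n (a # b # ws) u)
      + (\<Sum>(s, a, b, vs)\<leftarrow>cut_words i ws. s * trace_prod n ((w @ b @ a) # vs) u)"
    if "u \<in> space J" for u
  proof -
    note u = space_law[OF that]
    let ?W = "word_mat n u"
    have "(\<Sum>p<n. \<Sum>q<n. (\<Sum>(s, a, b)\<leftarrow>cut_word i w. s * (?W a $$ (p, p) * ?W b $$ (q, q))) * trace_prod n ws u)
      = (\<Sum>(s, a, b)\<leftarrow>cut_word i w. \<Sum>p<n. \<Sum>q<n. s * (?W a $$ (p, p) * ?W b $$ (q, q)) * trace_prod n ws u)"
      by (simp add: sum_sum_list case_prod_unfold flip: sum_list_mult_const)
    also have "\<dots> = (\<Sum>(s, a, b)\<leftarrow>cut_word i w. s * trace_prod n (a # b # ws) u)"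
    proof (rule arg_cong[where f = sum_list], rule map_cong[OF refl], clarify)
      fix s a b assume "(s, a, b) \<in> set (cut_word i w)"
      then have "fst ` set a \<subseteq> {..<r}" "fst ` set b \<subseteq> {..<r}" using cut_word_letters[OF _ w] by blast+
      then have "s * trace_prod n (a # b # ws) u
        = s * ((\<Sum>p<n. ?W a $$ (p, p)) * (\<Sum>q<n. ?W b $$ (q, q))) * trace_prod n ws u"
        by (simp add: word_trace_eq[OF u] mult_ac)
      then show "(\<Sum>p<n. \<Sum>q<n. s * (?W a $$ (p, p) * ?W b $$ (q, q)) * trace_prod n ws u)
        = s * trace_prod n (a # b # ws) u"
        unfolding sum_product by (simp only: sum_distrib_left sum_distrib_right)
    qed
    finally have 1: "(\<Sum>p<n. \<Sum>q<n. (\<Sum>(s, a, b)\<leftarrow>cut_word i w. s * (?W a $$ (p, p) * ?W b $$ (q, q))) * trace_prod n ws u)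
      = (\<Sum>(s, a, b)\<leftarrow>cut_word i w. s * trace_prod n (a # b # ws) u)" .
    have "(\<Sum>p<n. \<Sum>q<n. ?W w $$ (p, q) *
        (\<Sum>(s, a, b, vs)\<leftarrow>cut_words i ws. s * ?W (b @ a) $$ (q, p) * trace_prod n vs u))
      = (\<Sum>(s, a, b, vs)\<leftarrow>cut_words i ws. \<Sum>p<n. \<Sum>q<n. ?W w $$ (p, q) * (s * ?W (b @ a) $$ (q, p) * trace_prod n vs u))"
      by (simp add: sum_sum_list case_prod_unfold flip: sum_list_const_mult)
    also have "\<dots> = (\<Sum>(s, a, b, vs)\<leftarrow>cut_words i ws. s * trace_prod n ((w @ b @ a) # vs) u)"
    proof (rule arg_cong[where f = sum_list], rule map_cong[OF refl], clarify)
      fix s a b vs assume "(s, a, b, vs) \<in> set (cut_words i ws)"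
      then have "fst ` set (b @ a) \<subseteq> {..<r}" using cut_words_letters[OF _ ws] by (simp add: image_Un)
      then show "(\<Sum>p<n. \<Sum>q<n. ?W w $$ (p, q) * (s * ?W (b @ a) $$ (q, p) * trace_prod n vs u))
        = s * trace_prod n ((w @ b @ a) # vs) u"
        by (simp add: word_trace_append[OF u w] sum_distrib_left sum_distrib_right mult_ac)
    qed
    finally show ?thesis using 1 by (simp add: loop_term_def sum.distrib)
  qed
  have int: "integrable J (trace_prod n vs)" if "\<forall>w\<in>set vs. fst ` set w \<subseteq> {..<r}" for vs
    by (intro bounded_measurable_integrable bounded_measurable_trace_prod that)
  have int1: "integrable J (\<lambda>u. fst z * trace_prod n (fst (snd z) # snd (snd z) # ws) u)"
    if "z \<in> set (cut_word i w)" for z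
    using cut_word_letters[of "fst z" "fst (snd z)" "snd (snd z)", OF _ w] that ws
    by (intro integrable_mult_right int) auto
  have int2: "integrable J (\<lambda>u. fst z * trace_prod n ((w @ fst (snd (snd z)) @ fst (snd z)) # snd (snd (snd z))) u)"
    if "z \<in> set (cut_words i ws)" for z
    using cut_words_letters[of "fst z" "fst (snd z)" "fst (snd (snd z))" "snd (snd (snd z))", OF _ ws] that w
    by (intro integrable_mult_right int) (auto simp: image_Un simp del: image_subset_iff)
  have "0 = (\<Sum>p<n. \<Sum>q<n. \<integral>u. loop_term i w ws p q p q u \<partial>J)"
    by (simp add: expectation_loop_term[OF i w ws])
  also have "\<dots> = (\<integral>u. (\<Sum>p<n. \<Sum>q<n. loop_term i w ws p q p q u) \<partial>J)"
    by (intro integral_double_sum[symmetric] bounded_measurable_integrable bounded_measurable_loop_term w ws)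
  also have "\<dots> = (\<integral>u. (\<Sum>(s, a, b)\<leftarrow>cut_word i w. s * trace_prod n (a # b # ws) u)
      + (\<Sum>(s, a, b, vs)\<leftarrow>cut_words i ws. s * trace_prod n ((w @ b @ a) # vs) u) \<partial>J)"
    by (intro Bochner_Integration.integral_cong refl pointwise)
  also have "\<dots> = (\<Sum>(s, a, b)\<leftarrow>cut_word i w. s * mean (a # b # ws))
    + (\<Sum>(s, a, b, vs)\<leftarrow>cut_words i ws. s * mean ((w @ b @ a) # vs))"
    using integral_sum_list[of "cut_word i w", OF int1] integral_sum_list[of "cut_words i ws", OF int2]
    by (simp add: mean_def case_prod_unfold del: trace_prod_simps)
  finally show ?thesis by simp
qed

lemma norm_mean_le:
  assumes ws: "\<forall>w\<in>set ws. fst ` set w \<subseteq> {..<r}"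
  shows "norm (mean ws) \<le> real n ^ length ws"
proof -
  have bound: "norm (trace_prod n ws u) \<le> real n ^ length ws" if "u \<in> space J" for u
    using ws
  proof (induction ws)
    case (Cons w ws)
    have "norm (word_trace n u w) \<le> real n"
      unfolding word_trace_def using Cons.prems
      by (intro unitary_trace_bound word_mat_closed[OF space_law[OF that]]) simp
    then show ?case using Cons by (auto simp: norm_mult intro!: mult_mono)
  qed simp
  have "norm (mean ws) \<le> (\<integral>u. norm (trace_prod n ws u) \<partial>J)"
    unfolding mean_def by (rule integral_norm_bound)
  also have "\<dots> \<le> (\<integral>u. real n ^ length ws \<partial>J)"
    by (intro integral_mono integrable_norm bounded_measurable_integrable bounded_measurable_trace_prod ws bound) auto
  finally show ?thesis by (simp add: prob_space)
qed

lemma mean_cong: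
  assumes "\<And>u. u \<in> unitary_tuples n r \<Longrightarrow> word_trace n u v = word_trace n u w"
  shows "mean (v # ws) = mean (w # ws)"
  unfolding mean_def by (rule Bochner_Integration.integral_cong) (auto simp: assms space_law)

lemma mean_Nil: "mean ([] # ws) = of_nat n * mean ws"
  by (simp add: mean_def word_trace_Nil)

end

text \<open>All expectations are taken with respect to this law, on a space that depends on \<open>n\<close> and \<open>r\<close> only.\<close>

definition joint_law :: "'a measure \<Rightarrow> nat \<Rightarrow> nat \<Rightarrow> (nat \<Rightarrow> 'a \<Rightarrow> complex mat) \<Rightarrow> (nat \<Rightarrow> complex mat) measure"
  where "joint_law M n r U = distr M (\<Pi>\<^sub>M i\<in>{..<r}. unitary_borel n) (\<lambda>x. \<lambda>i\<in>{..<r}. U i x)"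

text \<open>Multiplying the \<open>i\<close>-th matrix by \<open>V\<close> keeps the family independent and, by invariance of the Haar measure, keeps
every marginal; the joint law is the product of the marginals.\<close>

lemma joint_law_invariant:
  assumes "indep_haar_unitaries M n r U"
  shows "invariant_law (joint_law M n r U) n r"
proof -
  let ?B = "unitary_borel n" and ?I = "{..<r}" and ?J = "joint_law M n r U"
  interpret prob_space M using assms by (simp add: indep_haar_unitaries_def)
  interpret G: group "unitary_group n" by (rule unitary_group_is_group)
  have indep: "indep_vars (\<lambda>_. ?B) U ?I"
    and haar: "\<And>i. i < r \<Longrightarrow> is_haar_prob n (distr M ?B (U i))"
    using assms by (auto simp: indep_haar_unitaries_def)
  have meas: "U i \<in> M \<rightarrow>\<^sub>M ?B" if "i < r" for i
    using indep that by (auto simp: indep_vars_def)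
  have tuple: "(\<lambda>x. \<lambda>i\<in>?I. U i x) \<in> M \<rightarrow>\<^sub>M (\<Pi>\<^sub>M i\<in>?I. ?B)"
    by (rule measurable_restrict) (use meas in auto)
  have law: "distr M (\<Pi>\<^sub>M i\<in>?I. ?B) (\<lambda>x. \<lambda>i\<in>?I. X i x) = (\<Pi>\<^sub>M i\<in>?I. distr M ?B (X i))"
    if X: "indep_vars (\<lambda>_. ?B) X ?I" and "?I \<noteq> {}" for X
  proof -
    \<comment> \<open>The product formula for the joint law asks for measurability at every index, hence also outside \<open>?I\<close>.\<close>
    define Y where "Y = (\<lambda>i. if i < r then X i else (\<lambda>x. 1\<^sub>m n))"
    have "indep_vars (\<lambda>_. ?B) Y ?I \<longleftrightarrow> indep_vars (\<lambda>_. ?B) X ?I"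
      by (rule indep_vars_cong) (auto simp: Y_def)
    then have "indep_vars (\<lambda>_. ?B) Y ?I" using X by simp
    moreover have "Y i \<in> M \<rightarrow>\<^sub>M ?B" for i
      using X G.one_closed by (auto simp: Y_def indep_vars_def)
    ultimately have "distr M (\<Pi>\<^sub>M i\<in>?I. ?B) (\<lambda>x. \<lambda>i\<in>?I. Y i x) = (\<Pi>\<^sub>M i\<in>?I. distr M ?B (Y i))"
      using indep_vars_iff_distr_eq_PiM[OF \<open>?I \<noteq> {}\<close>, where X = Y and M' = "\<lambda>_. ?B"] by simp
    moreover have "(\<lambda>x. \<lambda>i\<in>?I. Y i x) = (\<lambda>x. \<lambda>i\<in>?I. X i x)"
      by (auto simp: Y_def fun_eq_iff)
    moreover have "(\<Pi>\<^sub>M i\<in>?I. distr M ?B (Y i)) = (\<Pi>\<^sub>M i\<in>?I. distr M ?B (X i))"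
      by (rule PiM_cong) (auto simp: Y_def)
    ultimately show ?thesis by simp
  qed
  show ?thesis
  proof (intro invariant_law.intro invariant_law_axioms.intro)
    show "prob_space ?J" unfolding joint_law_def by (rule prob_space_distr[OF tuple])
    show sets: "sets ?J = sets (\<Pi>\<^sub>M i\<in>?I. ?B)" by (simp add: joint_law_def)
    fix i V assume i: "i < r" and V: "V \<in> carrier (unitary_group n)"
    let ?X = "\<lambda>j. if j = i then (\<lambda>x. V * U i x) else U j"
    have upd: "(\<lambda>u. u(i := V * u i)) \<in> (\<Pi>\<^sub>M i\<in>?I. ?B) \<rightarrow>\<^sub>M (\<Pi>\<^sub>M i\<in>?I. ?B)"
    proof (rule measurable_fun_upd[where J = ?I])
      show "(\<lambda>u. V * u i) \<in> (\<Pi>\<^sub>M i\<in>?I. ?B) \<rightarrow>\<^sub>M ?B"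
        by (rule measurable_compose[OF _ measurable_left_mult[OF V]], rule measurable_component_singleton)
          (use i in simp)
    qed (use i in auto)
    have "indep_vars (\<lambda>_. ?B) (\<lambda>j x. (if j = i then (\<lambda>A. V * A) else (\<lambda>A. A)) (U j x)) ?I"
      using measurable_left_mult[OF V] by (intro indep_vars_compose2[OF indep]) auto
    moreover have "(\<lambda>j x. (if j = i then (\<lambda>A. V * A) else (\<lambda>A. A)) (U j x)) = ?X"
      by (auto simp: fun_eq_iff)
    ultimately have indep': "indep_vars (\<lambda>_. ?B) ?X ?I" by simp
    have marginal: "distr M ?B (\<lambda>x. V * U i x) = distr M ?B (U i)"
    proof -
      let ?\<mu> = "distr M ?B (U i)"
      have "distr M ?B (\<lambda>x. V * U i x) = distr ?\<mu> ?B (\<lambda>A. V * A)"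
        using distr_distr[OF measurable_left_mult[OF V] meas[OF i]] by (simp add: o_def)
      also have "\<dots> = distr ?\<mu> ?\<mu> (\<lambda>A. V * A)" by (rule distr_cong) auto
      also have "\<dots> = ?\<mu>" using haar[OF i] V by (simp add: is_haar_prob_def)
      finally show ?thesis .
    qed
    have "distr ?J ?J (\<lambda>u. u(i := V * u i)) = distr ?J (\<Pi>\<^sub>M i\<in>?I. ?B) (\<lambda>u. u(i := V * u i))"
      by (rule distr_cong) (auto simp: sets)
    also have "\<dots> = distr M (\<Pi>\<^sub>M i\<in>?I. ?B) ((\<lambda>u. u(i := V * u i)) \<circ> (\<lambda>x. \<lambda>i\<in>?I. U i x))"
      unfolding joint_law_def by (rule distr_distr[OF upd tuple])
    also have "(\<lambda>u. u(i := V * u i)) \<circ> (\<lambda>x. \<lambda>i\<in>?I. U i x) = (\<lambda>x. \<lambda>j\<in>?I. ?X j x)"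
      using i by (auto simp: fun_eq_iff)
    also have "distr M (\<Pi>\<^sub>M i\<in>?I. ?B) (\<lambda>x. \<lambda>j\<in>?I. ?X j x) = (\<Pi>\<^sub>M j\<in>?I. distr M ?B (?X j))"
      using i by (intro law indep') auto
    also have "\<dots> = (\<Pi>\<^sub>M j\<in>?I. distr M ?B (U j))"
      by (rule PiM_cong) (auto simp: marginal)
    also have "\<dots> = ?J" unfolding joint_law_def using i by (intro law[symmetric] indep) auto
    finally show "distr ?J ?J (\<lambda>u. u(i := V * u i)) = ?J" .
  qed
qed

lemma letter_mat_cong: "u (fst x) = u' (fst x) \<Longrightarrow> letter_mat n u x = letter_mat n u' x"
  by (simp add: letter_mat_def)

lemma word_mat_cong: "(\<And>x. x \<in> set w \<Longrightarrow> u (fst x) = u' (fst x)) \<Longrightarrow> word_mat n u w = word_mat n u' w"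
  by (induction w) (auto simp: word_mat_Nil word_mat_Cons intro!: arg_cong2[where f = "(*)"] letter_mat_cong)

lemma expected_trace_eq_mean:
  assumes "indep_haar_unitaries M n r U" and w: "fst ` set w \<subseteq> {..<r}"
  shows "expected_trace M n w U = invariant_law.mean (joint_law M n r U) n [w]"
proof -
  let ?B = "unitary_borel n" and ?I = "{..<r}"
  interpret invariant_law "joint_law M n r U" n r by (rule joint_law_invariant[OF assms(1)])
  interpret M: prob_space M using assms by (simp add: indep_haar_unitaries_def)
  have tuple: "(\<lambda>x. \<lambda>i\<in>?I. U i x) \<in> M \<rightarrow>\<^sub>M (\<Pi>\<^sub>M i\<in>?I. ?B)"
    by (rule measurable_restrict) (use assms in \<open>auto simp: indep_haar_unitaries_def M.indep_vars_def\<close>)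
  have "bounded_measurable (trace_prod n [w])" by (rule bounded_measurable_trace_prod) (use w in auto)
  then have "trace_prod n [w] \<in> borel_measurable (joint_law M n r U)"
    unfolding bounded_measurable_def by blast
  then have "trace_prod n [w] \<in> borel_measurable (\<Pi>\<^sub>M i\<in>?I. ?B)"
    by (simp add: joint_law_def)
  then have "mean [w] = (\<integral>x. trace_prod n [w] (\<lambda>i\<in>?I. U i x) \<partial>M)"
    unfolding mean_def unfolding joint_law_def by (rule integral_distr[OF tuple])
  also have "\<dots> = expected_trace M n w U"
    unfolding expected_trace_def
  proof (rule Bochner_Integration.integral_cong[OF refl])
    fix x
    have "word_mat n (\<lambda>i\<in>?I. U i x) w = word_mat n (\<lambda>i. U i x) w"
      by (rule word_mat_cong) (use w in auto)
    then show "trace_prod n [w] (\<lambda>i\<in>?I. U i x) = mat_trace (word_mat n (\<lambda>i. U i x) w)"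
      by (simp add: word_trace_def)
  qed
  finally show ?thesis by simp
qed

section \<open>The induction on surfaces\<close>

text \<open>The bound is demanded from \<open>n = 1\<close> on instead of eventually, which makes it a plain inequality between
numbers; the value at \<open>n = 0\<close> is left free.\<close>

definition order_at_most :: "int \<Rightarrow> (nat \<Rightarrow> complex) \<Rightarrow> bool" where
  "order_at_most e f \<longleftrightarrow> (\<exists>C. \<forall>n\<ge>1. norm (f n) \<le> C * real n powi e)"

lemma order_at_mostI: "(\<And>n. n \<ge> 1 \<Longrightarrow> norm (f n) \<le> C * real n powi e) \<Longrightarrow> order_at_most e f"
  unfolding order_at_most_def by blast

lemma order_at_most_0: "order_at_most e (\<lambda>n. 0)"
  by (rule order_at_mostI[where C = 0]) simp

lemma order_at_most_add:
  assumes "order_at_most e f" "order_at_most e g"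
  shows "order_at_most e (\<lambda>n. f n + g n)"
proof -
  obtain C D where "\<And>n. n \<ge> 1 \<Longrightarrow> norm (f n) \<le> C * real n powi e"
    "\<And>n. n \<ge> 1 \<Longrightarrow> norm (g n) \<le> D * real n powi e"
    using assms unfolding order_at_most_def by blast
  then show ?thesis
    by (intro order_at_mostI[where C = "C + D"] norm_triangle_le) (simp add: distrib_right add_mono)
qed

lemma order_at_most_sum_list:
  assumes "\<And>z. z \<in> set zs \<Longrightarrow> norm (c z) = 1" "\<And>z. z \<in> set zs \<Longrightarrow> order_at_most e (f z)"
  shows "order_at_most e (\<lambda>n. \<Sum>z\<leftarrow>zs. c z * f z n)"
  using assms
proof (induction zs)
  case (Cons z zs)
  have "order_at_most e (\<lambda>n. c z * f z n)"
    using Cons.prems(1)[of z] Cons.prems(2)[of z] unfolding order_at_most_def by (simp add: norm_mult)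
  moreover have "order_at_most e (\<lambda>n. \<Sum>z\<leftarrow>zs. c z * f z n)"
    using Cons by simp
  ultimately show ?case by (simp add: order_at_most_add)
qed (simp add: order_at_most_0)

lemma powi_add_1: "n \<ge> 1 \<Longrightarrow> real n powi (e + 1) = real n * real n powi e"
  by (simp add: power_int_add)

text \<open>A strictly superadditive measure of length: cutting a word into two nonempty parts makes it smaller, although
the number of words grows.  The summand \<open>1\<close> makes it decrease when an empty word is dropped.\<close>

definition weight :: "letter list list \<Rightarrow> nat" where
  "weight ws = (\<Sum>v\<leftarrow>ws. (length v)\<^sup>2 + 1)"

lemma weight_split: "a \<noteq> [] \<Longrightarrow> b \<noteq> [] \<Longrightarrow> weight (a # b # ws) < weight ((a @ b) # ws)"
  by (cases a; cases b) (auto simp: weight_def power2_eq_square algebra_simps)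

locale law_sequence =
  fixes J :: "nat \<Rightarrow> (nat \<Rightarrow> complex mat) measure" and r :: nat and w :: "letter list"
  assumes law: "n \<ge> 1 \<Longrightarrow> invariant_law (J n) n r"
begin

abbreviation "F \<equiv> free_group r"
abbreviation "g \<equiv> commutator_length F w"

sublocale F: group F by (rule free_group_is_group)

definition E :: "letter list list \<Rightarrow> nat \<Rightarrow> complex" where
  "E ws n = invariant_law.mean (J n) n ws"

text \<open>The words \<open>ws\<close> bound a connected surface of genus \<open>h\<close> together with \<open>w\<close>.\<close>

definition admissible :: "letter list list \<Rightarrow> nat \<Rightarrow> bool" where
  "admissible ws h \<longleftrightarrow> (\<forall>v\<in>set ws. fst ` set v \<subseteq> {..<r}) \<and> cobordism F (mset (map reduce ws)) h w"

text \<open>The exponent is the Euler characteristic \<open>1 - 2 g\<close> of the optimal surface bounded by \<open>w\<close> minus the Euler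
characteristic \<open>1 - 2 h - k\<close> of the surface between \<open>w\<close> and the \<open>k\<close> words.\<close>

definition surface_bound :: "letter list list \<Rightarrow> nat \<Rightarrow> bool" where
  "surface_bound ws h \<longleftrightarrow> order_at_most (int (length ws) + 2 * int h - 2 * int g) (E ws)"

lemma surface_bound_cong:
  assumes "surface_bound vs h" "length vs = length ws" "\<And>n. n \<ge> 1 \<Longrightarrow> E vs n = E ws n"
  shows "surface_bound ws h"
  using assms unfolding surface_bound_def order_at_most_def by simp

lemma surface_bound_trivial:
  assumes "admissible ws h" "g \<le> h"
  shows "surface_bound ws h"
  unfolding surface_bound_def
proof (rule order_at_mostI[where C = 1])
  fix n :: nat assume n: "n \<ge> 1"
  interpret invariant_law "J n" n r by (rule law[OF n])
  have "norm (E ws n) \<le> real n ^ length ws"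
    unfolding E_def using assms(1) by (intro norm_mean_le) (simp add: admissible_def)
  also have "\<dots> = real n powi int (length ws)" by simp
  also have "\<dots> \<le> real n powi (int (length ws) + 2 * int h - 2 * int g)"
    using n assms(2) by (intro power_int_increasing) auto
  finally show "norm (E ws n) \<le> 1 * real n powi (int (length ws) + 2 * int h - 2 * int g)" by simp
qed

lemma surface_bound_drop_Nil:
  assumes "surface_bound ws h"
  shows "surface_bound ([] # ws) h"
proof -
  obtain C where C: "\<And>n. n \<ge> 1 \<Longrightarrow> norm (E ws n) \<le> C * real n powi (int (length ws) + 2 * int h - 2 * int g)"
    using assms unfolding surface_bound_def order_at_most_def by blast
  show ?thesis unfolding surface_bound_def
  proof (rule order_at_mostI[where C = C])
    fix n :: nat assume n: "n \<ge> 1"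
    interpret invariant_law "J n" n r by (rule law[OF n])
    have "norm (E ([] # ws) n) = real n * norm (E ws n)"
      by (simp add: E_def mean_Nil norm_mult)
    also have "\<dots> \<le> real n * (C * real n powi (int (length ws) + 2 * int h - 2 * int g))"
      by (intro mult_left_mono C n) simp
    also have "\<dots> = C * real n powi (int (length ws) + 2 * int h - 2 * int g + 1)"
      using n by (simp add: powi_add_1)
    finally show "norm (E ([] # ws) n) \<le> C * real n powi (int (length ([] # ws)) + 2 * int h - 2 * int g)"
      by (simp add: algebra_simps)
  qed
qed

lemma admissible_split:
  assumes "admissible ((a @ b) # ws) h"
  shows "admissible (a # b # ws) h"
proof -
  have ab: "fst ` set a \<subseteq> {..<r}" "fst ` set b \<subseteq> {..<r}"
    using assms by (auto simp: admissible_def)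
  have "cobordism F (add_mset (reduce a \<otimes>\<^bsub>F\<^esub> reduce b) (mset (map reduce ws))) h w"
    using assms reduce_append[of a b r] by (simp add: admissible_def)
  then have "cobordism F (add_mset (reduce a) (add_mset (reduce b) (mset (map reduce ws)))) h w"
    by (intro F.cobordism_split reduce_in_free_group ab)
  then show ?thesis using assms by (auto simp: admissible_def)
qed

lemma admissible_merge:
  assumes adm: "admissible (v # ws) h" and cut: "(s, a, b, vs) \<in> set (cut_words i ws)"
  shows "admissible ((v @ b @ a) # vs) (Suc h)"
proof -
  have mset: "mset ws = add_mset (a @ b) (mset vs)" by (rule cut_words_mset[OF cut])
  have letters: "fst ` set a \<subseteq> {..<r}" "fst ` set b \<subseteq> {..<r}" "\<forall>u\<in>set vs. fst ` set u \<subseteq> {..<r}"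
    using cut_words_letters[OF cut, of "{..<r}"] adm by (auto simp: admissible_def)
  have "mset (map reduce (v # ws))
      = add_mset (reduce v) (add_mset (reduce a \<otimes>\<^bsub>F\<^esub> reduce b) (mset (map reduce vs)))"
    using mset reduce_append[of a b r] by simp
  then have "cobordism F (add_mset (reduce v) (add_mset (reduce a \<otimes>\<^bsub>F\<^esub> reduce b) (mset (map reduce vs)))) h w"
    using adm unfolding admissible_def by metis
  then have "cobordism F (add_mset (reduce v \<otimes>\<^bsub>F\<^esub> reduce b \<otimes>\<^bsub>F\<^esub> reduce a) (mset (map reduce vs))) (Suc h) w"
    by (intro F.cobordism_merge reduce_in_free_group letters)
  moreover have "reduce v \<otimes>\<^bsub>F\<^esub> reduce b \<otimes>\<^bsub>F\<^esub> reduce a = reduce (v @ b @ a)"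
    using reduce_append[of v b r] reduce_append[of "v @ b" a r] by simp
  ultimately show ?thesis
    using adm letters by (auto simp: admissible_def)
qed

text \<open>The loop equation, solved for the expectation of \<open>v # ws\<close>.  If exactly one end of \<open>v\<close> contributes a cut, this
expectation occurs with the coefficient \<open>n\<close> or \<open>- n\<close>; if both ends did, the two terms would cancel.\<close>

lemma loop_step:
  assumes adm: "admissible (v # ws) h" and v: "v \<noteq> []" and i: "i < r"
    and one_end: "(hd v = (i, True)) \<noteq> (last v = (i, False))"
    and split: "\<And>ws'. weight ws' < weight (v # ws) \<Longrightarrow> admissible ws' h \<Longrightarrow> surface_bound ws' h"
    and merge: "\<And>ws'. admissible ws' (Suc h) \<Longrightarrow> surface_bound ws' (Suc h)"
  shows "surface_bound (v # ws) h"
proof -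
  let ?e = "int (length (v # ws)) + 2 * int h - 2 * int g"
  define S where "S = (\<lambda>n. (\<Sum>(s, a, b)\<leftarrow>proper_cuts i v. s * E (a # b # ws) n)
    + (\<Sum>(s, a, b, vs)\<leftarrow>cut_words i ws. s * E ((v @ b @ a) # vs) n))"
  have "order_at_most (?e + 1) (\<lambda>n. \<Sum>z\<leftarrow>proper_cuts i v. fst z * E (fst (snd z) # snd (snd z) # ws) n)"
  proof (rule order_at_most_sum_list)
    fix z assume "z \<in> set (proper_cuts i v)"
    moreover obtain s a b where z: "z = (s, a, b)" by (cases z)
    ultimately have cut: "(s, a, b) \<in> set (cut_word i v)" and ne: "a \<noteq> []" "b \<noteq> []"
      by (auto simp: proper_cuts_def)
    then have ab: "a @ b = v" by (intro cut_word_append)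
    show "norm (fst z) = 1" using cut_word_sign[OF cut] by (simp add: z)
    have "surface_bound (a # b # ws) h"
      using weight_split[OF ne, of ws] admissible_split[of a b ws h] adm ab by (intro split) auto
    then show "order_at_most (?e + 1) (E (fst (snd z) # snd (snd z) # ws))"
      by (simp add: z surface_bound_def algebra_simps)
  qed
  moreover have "order_at_most (?e + 1) (\<lambda>n. \<Sum>z\<leftarrow>cut_words i ws.
      fst z * E ((v @ fst (snd (snd z)) @ fst (snd z)) # snd (snd (snd z))) n)"
  proof (rule order_at_most_sum_list)
    fix z assume "z \<in> set (cut_words i ws)"
    moreover obtain s a b vs where z: "z = (s, a, b, vs)" by (cases z)
    ultimately have cut: "(s, a, b, vs) \<in> set (cut_words i ws)" by simp
    show "norm (fst z) = 1" using cut_words_sign[OF cut] by (simp add: z)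
    have "length ws = Suc (length vs)"
      using arg_cong[OF cut_words_mset[OF cut], of size] by simp
    moreover have "surface_bound ((v @ b @ a) # vs) (Suc h)" by (intro merge admissible_merge[OF adm cut])
    ultimately show "order_at_most (?e + 1) (E ((v @ fst (snd (snd z)) @ fst (snd z)) # snd (snd (snd z))))"
      by (simp add: z surface_bound_def algebra_simps)
  qed
  ultimately have "order_at_most (?e + 1) S"
    unfolding S_def case_prod_unfold by (rule order_at_most_add)
  then obtain C where C: "\<And>n. n \<ge> 1 \<Longrightarrow> norm (S n) \<le> C * real n powi (?e + 1)"
    unfolding order_at_most_def by blast
  show ?thesis unfolding surface_bound_def
  proof (rule order_at_mostI[where C = C])
    fix n :: nat assume n: "n \<ge> 1"
    interpret invariant_law "J n" n r by (rule law[OF n])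
    have "mean (v # [] # ws) = of_nat n * mean (v # ws)"
      using mean_Nil[of "v # ws"] by (simp add: mean_def mult_ac)
    then have "S n + (if hd v = (i, True) then of_nat n * E (v # ws) n else 0)
        + (if last v = (i, False) then - (of_nat n * E (v # ws) n) else 0) = 0"
      using loop_equation[OF i, of v ws] sum_cut_word[OF v, of "\<lambda>s a b. s * mean (a # b # ws)" i] adm
      by (simp add: S_def E_def admissible_def mean_Nil algebra_simps cong: if_cong)
    then have "S n = of_nat n * E (v # ws) n \<or> S n = - (of_nat n * E (v # ws) n)"
      using one_end by (cases "hd v = (i, True)") (auto simp: eq_neg_iff_add_eq_0)
    then have "real n * norm (E (v # ws) n) = norm (S n)"
      by (auto simp: norm_mult)
    also have "\<dots> \<le> real n * (C * real n powi ?e)"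
      using C[OF n] n by (simp add: powi_add_1 mult_ac del: of_nat_Suc length_Cons)
    finally show "norm (E (v # ws) n) \<le> C * real n powi ?e" using n by simp
  qed
qed

text \<open>A word \<open>x a x\<^sup>-\<^sup>1\<close> has the same trace and the same conjugacy class as \<open>a\<close>.  This covers the words for which
the two end terms of the loop equation cancel.\<close>

lemma surface_bound_conj:
  assumes adm: "admissible ((x # a @ [inv_letter x]) # ws) h"
    and IH: "\<And>ws'. weight ws' < weight ((x # a @ [inv_letter x]) # ws) \<Longrightarrow> admissible ws' h \<Longrightarrow> surface_bound ws' h"
  shows "surface_bound ((x # a @ [inv_letter x]) # ws) h"
proof (rule surface_bound_cong)
  have a: "fst ` set a \<subseteq> {..<r}" and x: "fst x < r" using adm by (auto simp: admissible_def)
  have "cobordism F (add_mset (reduce [x] \<otimes>\<^bsub>F\<^esub> reduce a \<otimes>\<^bsub>F\<^esub> inv\<^bsub>F\<^esub> reduce [x]) (mset (map reduce ws))) h w"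
    using adm reduce_conj[OF a x] by (simp add: admissible_def)
  then have "cobordism F (add_mset (reduce a) (mset (map reduce ws))) h w"
    using a x by (elim F.cobordism_conj) (auto intro!: reduce_in_free_group)
  then have "admissible (a # ws) h" using adm by (auto simp: admissible_def)
  then show "surface_bound (a # ws) h"
    by (intro IH) (auto simp: weight_def power2_eq_square)
  fix n :: nat assume n: "n \<ge> 1"
  interpret invariant_law "J n" n r by (rule law[OF n])
  show "E (a # ws) n = E ((x # a @ [inv_letter x]) # ws) n"
    unfolding E_def by (rule mean_cong) (simp add: word_trace_conj[OF _ a x])
qed simp

lemma surface_bound_positive_head:
  assumes adm: "admissible (((i, True) # v) # ws) h"
    and IH: "\<And>ws'. weight ws' < weight (((i, True) # v) # ws) \<Longrightarrow> admissible ws' h \<Longrightarrow> surface_bound ws' h"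
    and merge: "\<And>ws'. admissible ws' (Suc h) \<Longrightarrow> surface_bound ws' (Suc h)"
  shows "surface_bound (((i, True) # v) # ws) h"
proof (cases "last ((i, True) # v) = (i, False)")
  case True
  then obtain a where "v = a @ [inv_letter (i, True)]"
    by (cases v rule: rev_cases) (auto simp: inv_letter_def)
  then show ?thesis using surface_bound_conj[of "(i, True)" a ws h] adm IH by simp
next
  case False
  have "i < r" using adm by (auto simp: admissible_def)
  then show ?thesis using False by (intro loop_step adm IH merge) auto
qed

text \<open>By rotation the head word can be made to begin with a generator or to end with the inverse of one: otherwise it
ends with a generator, which can be moved to the front.\<close>

lemma surface_bound_step:
  assumes adm: "admissible ws h" and "h < g"
    and IH: "\<And>ws'. weight ws' < weight ws \<Longrightarrow> admissible ws' h \<Longrightarrow> surface_bound ws' h"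
    and merge: "\<And>ws'. admissible ws' (Suc h) \<Longrightarrow> surface_bound ws' (Suc h)"
  shows "surface_bound ws h"
proof (cases ws)
  case Nil
  then have "g \<le> h" using adm F.cobordism_no_boundary[of h w] by (simp add: admissible_def)
  then show ?thesis using \<open>h < g\<close> by simp
next
  case (Cons v vs)
  note adm = adm[unfolded Cons] and IH = IH[unfolded Cons]
  have letters: "fst ` set v \<subseteq> {..<r}" using adm by (simp add: admissible_def)
  show ?thesis
  proof (cases "v = []")
    case True
    have "admissible vs h"
      using adm F.cobordism_drop_one[of "mset (map reduce vs)" h w]
      by (simp add: admissible_def True reduce_def)
    then show ?thesis unfolding Cons True
      by (intro surface_bound_drop_Nil IH) (auto simp: weight_def)
  next
    case False
    obtain u x where "v = u @ [x]" using False by (cases v rule: rev_cases) auto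
    moreover obtain i c where "x = (i, c)" by (cases x)
    ultimately have v: "v = u @ [(i, c)]" by simp
    have i: "i < r" and u: "fst ` set u \<subseteq> {..<r}" using letters by (auto simp: v)
    show ?thesis
    proof (cases "\<exists>j. hd v = (j, True)")
      case True
      then obtain j v' where "v = (j, True) # v'" using False by (cases v) auto
      then show ?thesis using surface_bound_positive_head[of j v' vs h] adm IH merge Cons by simp
    next
      case negative: False
      show ?thesis
      proof (cases c)
        case False
        then show ?thesis unfolding Cons using negative v
          by (intro loop_step[OF adm \<open>v \<noteq> []\<close> i] IH merge) auto
      next
        case True
        let ?x = "(i, True)"
        have vx: "v = u @ [?x]" using v True by simp
        have "cobordism F (add_mset (reduce u \<otimes>\<^bsub>F\<^esub> reduce [?x]) (mset (map reduce vs))) h w"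
          using adm vx reduce_append[of u "[?x]" r] by (simp add: admissible_def)
        then have "cobordism F (add_mset (reduce [?x] \<otimes>\<^bsub>F\<^esub> reduce u) (mset (map reduce vs))) h w"
          by (rule F.cobordism_swap) (use u i in \<open>auto intro!: reduce_in_free_group\<close>)
        then have "admissible ((?x # u) # vs) h"
          using adm u i reduce_append[of "[?x]" u r] by (auto simp: admissible_def)
        moreover have "weight ((?x # u) # vs) = weight (v # vs)"
          using arg_cong[OF vx, of length] by (simp add: weight_def)
        ultimately have "surface_bound ((?x # u) # vs) h"
          by (intro surface_bound_positive_head) (auto intro: IH merge)
        then show ?thesis unfolding Cons
        proof (rule surface_bound_cong)
          fix n :: nat assume n: "n \<ge> 1"
          interpret invariant_law "J n" n r by (rule law[OF n])
          have "word_trace n t (?x # u) = word_trace n t v" if "t \<in> unitary_tuples n r" for t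
            using word_trace_rotate[OF that, of "[?x]" u] i u vx by simp
          then show "E ((?x # u) # vs) n = E (v # vs) n"
            unfolding E_def by (rule mean_cong)
        qed simp
      qed
    qed
  qed
qed

theorem surface_bound_holds: "admissible ws h \<Longrightarrow> surface_bound ws h"
proof (induction "g - h" arbitrary: h ws rule: less_induct)
  case (less h)
  show ?case
  proof (cases "g \<le> h")
    case False
    then have merge: "\<And>ws'. admissible ws' (Suc h) \<Longrightarrow> surface_bound ws' (Suc h)"
      by (intro less.hyps) auto
    show ?thesis using less.prems
    proof (induction "weight ws" arbitrary: ws rule: less_induct)
      case (less ws)
      show ?case using False by (intro surface_bound_step[OF less.prems _ less.hyps merge]) auto
    qed
  qed (use less.prems surface_bound_trivial in auto)
qed

end

theorem theorem1p1:
  fixes r g :: nat and w :: "letter list"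
    and M :: "nat \<Rightarrow> 'a measure" and U :: "nat \<Rightarrow> nat \<Rightarrow> 'a \<Rightarrow> complex mat"
  assumes "w \<in> derived (free_group r) (carrier (free_group r))"
    and "g = commutator_length (free_group r) w"
    and "\<And>n. n \<ge> 1 \<Longrightarrow> indep_haar_unitaries (M n) n r (U n)"
  shows "(\<lambda>n. expected_trace (M n) n w (U n)) \<in> O(\<lambda>n. 1 / of_nat n powi (2 * int g - 1))"
proof -
  interpret law_sequence "\<lambda>n. joint_law (M n) n r (U n)" r w
    by (rule law_sequence.intro) (rule joint_law_invariant[OF assms(3)])
  have "derived F (carrier F) \<subseteq> carrier F"
    using F.derived_in_carrier[of "carrier F"] by simp
  then have w: "w \<in> carrier F" using assms(1) by blast
  then have letters: "fst ` set w \<subseteq> {..<r}" and red: "reduce w = w"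
    by (auto simp: free_group_def reduce_reduced)
  have "cobordism F {#w#} 0 (\<one>\<^bsub>F\<^esub> \<otimes>\<^bsub>F\<^esub> w \<otimes>\<^bsub>F\<^esub> inv\<^bsub>F\<^esub> \<one>\<^bsub>F\<^esub> \<otimes>\<^bsub>F\<^esub> \<one>\<^bsub>F\<^esub>)"
    by (intro cobordism.boundary cobordism.empty w F.one_closed)
  moreover have "\<one>\<^bsub>F\<^esub> \<otimes>\<^bsub>F\<^esub> w \<otimes>\<^bsub>F\<^esub> inv\<^bsub>F\<^esub> \<one>\<^bsub>F\<^esub> \<otimes>\<^bsub>F\<^esub> \<one>\<^bsub>F\<^esub> = w"
    using w by (simp del: free_group_simps)
  ultimately have "admissible [w] 0" using letters red by (simp add: admissible_def)
  then have "surface_bound [w] 0" by (rule surface_bound_holds)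
  then obtain C where C: "\<And>n. n \<ge> 1 \<Longrightarrow> norm (E [w] n) \<le> C * real n powi (1 - 2 * int g)"
    unfolding surface_bound_def order_at_most_def assms(2)[symmetric] by auto
  show ?thesis
  proof (rule bigoI[where c = C], rule eventually_sequentiallyI[of 1])
    fix n :: nat assume n: "1 \<le> n"
    have "norm (expected_trace (M n) n w (U n)) \<le> C * real n powi (1 - 2 * int g)"
      using C[OF n] unfolding E_def expected_trace_eq_mean[OF assms(3)[OF n] letters] .
    also have "real n powi (1 - 2 * int g) = norm (1 / of_nat n powi (2 * int g - 1) :: complex)"
    proof -
      have "real n powi (1 - 2 * int g) = inverse (real n powi (2 * int g - 1))"
        by (subst power_int_minus[symmetric]) simp
      then show ?thesis by (simp add: norm_divide norm_power_int inverse_eq_divide)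
    qed
    finally show "norm (expected_trace (M n) n w (U n))
        \<le> C * norm (1 / of_nat n powi (2 * int g - 1) :: complex)" .
  qed
qed

end
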